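(* Let $n=1$, let $H:\mathbb{R}\to\mathbb{R}$ satisfy the growth assumption (PI) (see context), and suppose $H$ has exactly three critical points: two local minima $m_1<m_2$ with $H(m_1)=0<\delta\le H(m_2)$ and a local maximum $s$ in between. Let $K>1$. For $A\ge0$ set $$\frac{1}{\rho^{\mathrm{PI}}_A}:=\frac{2\pi}{\sqrt{H''(m_2)\,|H''(s)|}}\exp\Bigl(\frac{H(s)-H(m_2)}{\tau_2}\Bigr)\bigl(1+A\sqrt{\tau_2}\,|\ln\tau_2|^{3/2}\bigr)+A.$$ Then for every $A\ge0$ there exist $C<\infty$ and $\tau_0\in(0,1)$ such that for all $0<\tau_1<\tau_2\le\tau_0$ with $\tau_2\ge K\tau_1$, $$\frac1{\rho^{\mathrm{PI}}_A}\le\bigl(1+C\sqrt{\tau_2}\,|\ln\tau_2|^{3/2}\bigr)\sup_{f\in H^1(\mu)}\frac{\operatorname{Var}_\mu(f)}{\mathcal{E}_\mu(f)}.$$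
   Context: Growth assumption (PI), for $n=1$: $H\in C^3(\mathbb{R},\mathbb{R})$ is nonnegative and Morse, i.e. $H''\neq0$ at every critical point; moreover for some constants $C_H>0$, $K_H\ge0$: $\liminf_{|x|\to\infty}|H'(x)|\ge C_H$ and $\liminf_{|x|\to\infty}(|H'(x)|^2-H''(x))\ge-K_H$. Measures: for $\tau>0$, $\nu^\tau$ is the probability measure on $\mathbb{R}$ with density $e^{-H(x)/\tau}/Z^\tau$. Put $\pi^+(x_1,x_2)=\nu^{\tau_1}(x_1)\nu^{\tau_2}(x_2)$, $\pi^-(x_1,x_2)=\nu^{\tau_2}(x_1)\nu^{\tau_1}(x_2)$ (densities on $\mathbb{R}\times\mathbb{R}$), $\mu=\frac12(\pi^++\pi^-)$, $\rho^\pm=\pi^\pm/(\pi^++\pi^-)$, $a_1=\tau_1\rho^++\tau_2\rho^-$, $a_2=\tau_2\rho^++\tau_1\rho^-$, and $\mathcal{E}_\mu(f)=\int(a_1|\partial_{x_1}f|^2+a_2|\partial_{x_2}f|^2)\,d\mu$. $H^1(\mu)=\{f:\int|\nabla f|^2\,d\mu<\infty\}$; the supremum is over $f$ with $\mathcal{E}_\mu(f)>0$. *)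

theory Defs
  imports "HOL-Analysis.Analysis"
begin

text \<open>Class \<open>C\<^sup>k\<close> on the whole space: all iterated partial derivatives up to order \<open>k\<close> exist
  and are continuous.\<close>

primrec C_k :: "nat \<Rightarrow> ('a::euclidean_space \<Rightarrow> real) \<Rightarrow> bool" where
  "C_k 0 f \<longleftrightarrow> continuous_on UNIV f"
| "C_k (Suc k) f \<longleftrightarrow> (\<forall>x. f differentiable (at x)) \<and>
     (\<forall>b\<in>Basis. C_k k (\<lambda>x. frechet_derivative f (at x) b))"

definition local_min :: "(real \<Rightarrow> real) \<Rightarrow> real \<Rightarrow> bool" where
  "local_min f x \<longleftrightarrow> (\<forall>\<^sub>F y in nhds x. f x \<le> f y)"

definition local_max :: "(real \<Rightarrow> real) \<Rightarrow> real \<Rightarrow> bool" where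
  "local_max f x \<longleftrightarrow> (\<forall>\<^sub>F y in nhds x. f y \<le> f x)"

definition test_function :: "('a::euclidean_space \<Rightarrow> real) \<Rightarrow> bool" where
  "test_function \<phi> \<longleftrightarrow> (\<forall>k. C_k k \<phi>) \<and> compact (closure {x. \<phi> x \<noteq> 0})"

definition locally_integrable :: "('a::euclidean_space \<Rightarrow> 'b::euclidean_space) \<Rightarrow> bool" where
  "locally_integrable f \<longleftrightarrow> (\<forall>S. compact S \<longrightarrow> set_integrable lborel S f)"

definition has_weak_gradient ::
    "('a::euclidean_space \<Rightarrow> real) \<Rightarrow> ('a \<Rightarrow> 'a) \<Rightarrow> bool"  (infix "has'_weak'_gradient" 50) where
  "f has_weak_gradient g \<longleftrightarrow> locally_integrable f \<and> locally_integrable g \<and>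
     (\<forall>\<phi>. test_function \<phi> \<longrightarrow> (\<forall>b\<in>Basis.
        (\<integral>x. f x * frechet_derivative \<phi> (at x) b \<partial>lborel) = - (\<integral>x. (g x \<bullet> b) * \<phi> x \<partial>lborel)))"

definition growth_PI :: "(real \<Rightarrow> real) \<Rightarrow> bool" where
  "growth_PI H \<longleftrightarrow>
     C_k 3 H \<and> (\<forall>x. 0 \<le> H x) \<and>
     (\<forall>x. deriv H x = 0 \<longrightarrow> deriv (deriv H) x \<noteq> 0) \<and>
     (\<exists>C_H > 0. \<exists>K_H \<ge> 0.
        Liminf at_infinity (\<lambda>x. ereal \<bar>deriv H x\<bar>) \<ge> ereal C_H \<and>
        Liminf at_infinity (\<lambda>x. ereal (\<bar>deriv H x\<bar>\<^sup>2 - deriv (deriv H) x)) \<ge> ereal (- K_H))"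

definition partition_fn :: "(real \<Rightarrow> real) \<Rightarrow> real \<Rightarrow> real" where
  "partition_fn H \<tau> = (\<integral>x. exp (- H x / \<tau>) \<partial>lborel)"

definition nu_density :: "(real \<Rightarrow> real) \<Rightarrow> real \<Rightarrow> real \<Rightarrow> real" where
  "nu_density H \<tau> x = exp (- H x / \<tau>) / partition_fn H \<tau>"

context
  fixes H :: "real \<Rightarrow> real" and \<tau>\<^sub>1 \<tau>\<^sub>2 :: real
begin

definition pi_plus :: "real \<times> real \<Rightarrow> real" where
  "pi_plus z = nu_density H \<tau>\<^sub>1 (fst z) * nu_density H \<tau>\<^sub>2 (snd z)"

definition pi_minus :: "real \<times> real \<Rightarrow> real" where
  "pi_minus z = nu_density H \<tau>\<^sub>2 (fst z) * nu_density H \<tau>\<^sub>1 (snd z)"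

definition mu :: "(real \<times> real) measure" where
  "mu = density lborel (\<lambda>z. ennreal ((pi_plus z + pi_minus z) / 2))"

definition rho_plus :: "real \<times> real \<Rightarrow> real" where
  "rho_plus z = pi_plus z / (pi_plus z + pi_minus z)"

definition rho_minus :: "real \<times> real \<Rightarrow> real" where
  "rho_minus z = pi_minus z / (pi_plus z + pi_minus z)"

definition a1 :: "real \<times> real \<Rightarrow> real" where
  "a1 z = \<tau>\<^sub>1 * rho_plus z + \<tau>\<^sub>2 * rho_minus z"

definition a2 :: "real \<times> real \<Rightarrow> real" where
  "a2 z = \<tau>\<^sub>2 * rho_plus z + \<tau>\<^sub>1 * rho_minus z"

text \<open>The Dirichlet form, as a function of the (weak) gradient \<open>g = (\<partial>\<^sub>1 f, \<partial>\<^sub>2 f)\<close> of \<open>f\<close>.\<close>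

definition dirichlet_form :: "(real \<times> real \<Rightarrow> real \<times> real) \<Rightarrow> ennreal" where
  "dirichlet_form g =
     (\<integral>\<^sup>+z. ennreal (a1 z * \<bar>fst (g z)\<bar>\<^sup>2 + a2 z * \<bar>snd (g z)\<bar>\<^sup>2) \<partial>mu)"

text \<open>The space \<open>H\<^sup>1(\<mu>)\<close>, presented as the set of pairs of a function and its weak gradient. The
  gradient is determined almost everywhere by the function, so the pairing adds no freedom.\<close>

definition H1 :: "((real \<times> real \<Rightarrow> real) \<times> (real \<times> real \<Rightarrow> real \<times> real)) set" where
  "H1 = {(f, g). f has_weak_gradient g \<and> (\<integral>\<^sup>+z. ennreal ((norm (g z))\<^sup>2) \<partial>mu) < \<infinity>}"

end

text \<open>The variance is extended-valued. If \<open>f\<close> is not integrable then its Bochner integral is \<open>0\<close>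
  and, \<open>M\<close> being a probability measure, the value is \<open>\<infinity>\<close>, as for every \<open>f\<close> outside \<open>L\<^sup>2\<close>.\<close>

definition Var :: "'a measure \<Rightarrow> ('a \<Rightarrow> real) \<Rightarrow> ennreal" where
  "Var M f = (\<integral>\<^sup>+z. ennreal ((f z - (\<integral>w. f w \<partial>M))\<^sup>2) \<partial>M)"

definition inv_rho_PI ::
    "(real \<Rightarrow> real) \<Rightarrow> real \<Rightarrow> real \<Rightarrow> real \<Rightarrow> real \<Rightarrow> real" where
  "inv_rho_PI H m\<^sub>2 s \<tau>\<^sub>2 A =
     2 * pi / sqrt (deriv (deriv H) m\<^sub>2 * \<bar>deriv (deriv H) s\<bar>) * exp ((H s - H m\<^sub>2) / \<tau>\<^sub>2)
       * (1 + A * sqrt \<tau>\<^sub>2 * \<bar>ln \<tau>\<^sub>2\<bar> powr (3/2)) + A"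

end

theory Submission
  imports Defs "HOL-Probability.Sinc_Integral" "HOL-Real_Asymp.Real_Asymp"
begin

text \<open>The supremum is bounded from below by a single test function of the second coordinate,
  \<open>f (x\<^sub>1, x\<^sub>2) = G x\<^sub>2\<close>: \<open>G\<close> vanishes left of an interval \<open>[s - r, s + r]\<close>, equals \<open>1\<close> right of it, and
  \<open>G'\<close> is proportional to \<open>exp (H / \<tau>\<^sub>2)\<close> on it. The variance is at least
  \<open>\<mu> (f = 1) * \<mu> (f = 0)\<close>; the second factor is nearly \<open>1\<close>, and the first is at least half the
  \<open>\<nu>\<close>-mass at temperature \<open>\<tau>\<^sub>2\<close> near \<open>m\<^sub>2\<close>. In the Dirichlet form the contribution of the component in
  which \<open>x\<^sub>2\<close> is at the low temperature \<open>\<tau>\<^sub>1\<close> is negligible, because \<open>H \<ge> \<delta>\<close> on the support of \<open>G'\<close>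
  and \<open>1 / \<tau>\<^sub>1 - 1 / \<tau>\<^sub>2 \<ge> (K - 1) / \<tau>\<^sub>2\<close>. The normalisation at \<open>\<tau>\<^sub>2\<close> cancels in the quotient, so
  that only lower bounds of Laplace type for \<open>\<integral> exp (- H / \<tau>\<^sub>2)\<close> near \<open>m\<^sub>2\<close> and \<open>\<integral> exp (H / \<tau>\<^sub>2)\<close> near
  \<open>s\<close> remain. All relative errors are \<open>O (sqrt \<tau>\<^sub>2)\<close>, better than claimed, and the summand \<open>A\<close> is
  absorbed since the prefactor grows exponentially in \<open>1 / \<tau>\<^sub>2\<close>.\<close>

section \<open>Scalar derivatives and Taylor expansion\<close>

text \<open>On the line \<open>Basis\<close> is \<open>{1}\<close>, so the single partial derivative
  is the Frechet derivative applied to \<open>1\<close>, which is \<open>deriv\<close>. This is the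
  bridge from \<open>C_k\<close> to one-variable calculus.\<close>

lemma C_k_Suc_real:
  fixes f :: "real \<Rightarrow> real"
  shows "C_k (Suc k) f \<longleftrightarrow> (\<forall>x. (f has_real_derivative deriv f x) (at x)) \<and> C_k k (deriv f)"
proof -
  have eq: "frechet_derivative f (at x) 1 = deriv f x" if "f differentiable (at x)" for x
  proof -
    have "(f has_real_derivative deriv f x) (at x)"
      using that DERIV_deriv_iff_real_differentiable by blast
    then have "(*) (deriv f x) = frechet_derivative f (at x)"
      by (intro frechet_derivative_at) (simp add: has_field_derivative_def)
    then show ?thesis
      by (metis mult.right_neutral)
  qed
  show ?thesis
  proof (cases "\<forall>x. f differentiable (at x)")
    case True
    then have "(\<lambda>x. frechet_derivative f (at x) 1) = deriv f"
      using eq by auto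
    with True show ?thesis
      by (simp add: DERIV_deriv_iff_real_differentiable)
  next
    case False
    then show ?thesis
      by (simp add: DERIV_deriv_iff_real_differentiable) blast
  qed
qed

lemma C_3_real:
  fixes f :: "real \<Rightarrow> real"
  assumes "C_k 3 f"
  shows "(f has_real_derivative deriv f x) (at x)"
    and "(deriv f has_real_derivative deriv (deriv f) x) (at x)"
    and "(deriv (deriv f) has_real_derivative deriv (deriv (deriv f)) x) (at x)"
    and "continuous_on S (deriv (deriv (deriv f)))"
  using assms unfolding numeral_3_eq_3 C_k_Suc_real
  by (auto intro: continuous_on_subset)

text \<open>Lagrange remainder: the third derivative is continuous, hence bounded by some
  \<open>B\<close> on the compact interval, and \<open>3! = 6\<close> gives
  \<open>M = B / 6\<close>.\<close>

lemma taylor_second_order: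
  fixes f :: "real \<Rightarrow> real"
  assumes "C_k 3 f" and "0 < r"
  obtains M where "M \<ge> 0" and "\<And>x. \<bar>x - c\<bar> \<le> r \<Longrightarrow>
    \<bar>f x - f c - deriv f c * (x - c) - deriv (deriv f) c / 2 * (x - c)\<^sup>2\<bar> \<le> M * \<bar>x - c\<bar> ^ 3"
proof -
  note D = C_3_real[OF assms(1)]
  have "compact (deriv (deriv (deriv f)) ` {c - r..c + r})"
    by (intro compact_continuous_image D compact_Icc)
  then obtain B where B: "\<And>x. x \<in> {c - r..c + r} \<Longrightarrow> \<bar>deriv (deriv (deriv f)) x\<bar> \<le> B"
    by (meson compact_imp_bounded bounded_real imageI)
  have "0 \<le> B"
    using B[of c] assms(2) by auto
  show ?thesis
  proof (rule that[of "B / 6"])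
    fix x assume x: "\<bar>x - c\<bar> \<le> r"
    show "\<bar>f x - f c - deriv f c * (x - c) - deriv (deriv f) c / 2 * (x - c)\<^sup>2\<bar>
        \<le> B / 6 * \<bar>x - c\<bar> ^ 3"
    proof (cases "x = c")
      case False
      have "\<exists>t. (if x < c then x < t \<and> t < c else c < t \<and> t < x) \<and>
          f x = (\<Sum>m<3. ((deriv ^^ m) f c / fact m) * (x - c) ^ m)
            + ((deriv ^^ 3) f t / fact 3) * (x - c) ^ 3"
        using x False assms(2)
        by (intro Taylor[where a="c - r" and b="c + r"])
           (auto simp: numeral_3_eq_3 less_Suc_eq D)
      then obtain t where t: "if x < c then x < t \<and> t < c else c < t \<and> t < x"
        and eq: "f x = (\<Sum>m<3. ((deriv ^^ m) f c / fact m) * (x - c) ^ m)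
            + ((deriv ^^ 3) f t / fact 3) * (x - c) ^ 3"
        by blast
      have "f x - f c - deriv f c * (x - c) - deriv (deriv f) c / 2 * (x - c)\<^sup>2
          = deriv (deriv (deriv f)) t / 6 * (x - c) ^ 3"
        unfolding eq by (simp add: numeral_3_eq_3 power2_eq_square)
      moreover have "\<bar>deriv (deriv (deriv f)) t\<bar> \<le> B"
        using x t by (intro B) (auto split: if_splits)
      ultimately show ?thesis
        by (simp only: abs_mult abs_divide power_abs abs_numeral)
           (auto intro!: mult_right_mono divide_right_mono)
    qed simp
  qed (use \<open>0 \<le> B\<close> in auto)
qed

section \<open>Lower bounds of Laplace type\<close>

text \<open>Since \<open>exp (- y) \<ge> 1 - y\<close>, the cubic error costs at most a factor
  \<open>1 - M / \<tau> * \<bar>x - c\<bar> ^ 3\<close>. A Gaussian of variance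
  \<open>\<tau> / k\<close> times one minus a cubic is therefore a minorant, and its integral is
  explicit through the third absolute moment.\<close>

lemma laplace_lower_bound:
  fixes h :: "real \<Rightarrow> real"
  assumes "0 < k" "0 < r" "0 \<le> M"
    and cont: "continuous_on {c - r..c + r} h"
    and le: "\<And>x. \<bar>x - c\<bar> \<le> r \<Longrightarrow> h x \<le> k / 2 * (x - c)\<^sup>2 + M * \<bar>x - c\<bar> ^ 3"
  obtains C where "C \<ge> 0" and "\<And>\<tau>. 0 < \<tau> \<Longrightarrow> \<tau> \<le> 1 \<Longrightarrow>
    sqrt (2 * pi * \<tau> / k) * (1 - C * sqrt \<tau>)
      \<le> (\<integral>x. indicator {c - r..c + r} x * exp (- h x / \<tau>) \<partial>lborel)"
proof (rule that[of "(M + 1 / r ^ 3) * (2 * sqrt (1 / k) ^ 3 * sqrt (2 / pi))"])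
  fix \<tau> :: real assume \<tau>: "0 < \<tau>" "\<tau> \<le> 1"
  define \<sigma> where "\<sigma> = sqrt (\<tau> / k)"
  \<comment> \<open>\<open>M / \<tau>\<close> pays for the cubic term in the bound on
    \<open>h\<close>; \<open>1 / r ^ 3\<close> makes the minorant nonpositive outside the
    interval.\<close>
  define B where "B = M / \<tau> + 1 / r ^ 3"
  have \<sigma>: "\<sigma> > 0" "\<sigma>\<^sup>2 = \<tau> / k"
    using \<tau> assms by (auto simp: \<sigma>_def)
  have "B \<ge> 0"
    using \<tau> assms by (auto simp: B_def)
  let ?n = "normal_density c \<sigma>"
  have n: "sqrt (2 * pi * \<sigma>\<^sup>2) * ?n x = exp (- (k / 2 * (x - c)\<^sup>2) / \<tau>)" for x
    using \<sigma> assms(1) \<tau>(1) by (simp add: normal_density_def field_simps)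
  have moment: "integrable lborel (\<lambda>x. ?n x * \<bar>x - c\<bar> ^ 3)"
      "(\<integral>x. ?n x * \<bar>x - c\<bar> ^ 3 \<partial>lborel) = 2 * \<sigma> ^ 3 * sqrt (2 / pi)"
    using normal_moment_abs_odd[of \<sigma> c 1] \<sigma>(1) by (auto simp: has_bochner_integral_iff)
  \<comment> \<open>For \<open>\<bar>x - c\<bar> > r\<close> the left-hand side is negative, so the truncation to \<open>[c - r, c + r]\<close>
    needs no estimate of the Gaussian tail.\<close>
  have pt: "sqrt (2 * pi * \<sigma>\<^sup>2) * (?n x - B * (?n x * \<bar>x - c\<bar> ^ 3))
      \<le> indicator {c - r..c + r} x * exp (- h x / \<tau>)" for x
  proof (cases "\<bar>x - c\<bar> \<le> r")
    case True
    have "1 - B * \<bar>x - c\<bar> ^ 3 \<le> 1 - M / \<tau> * \<bar>x - c\<bar> ^ 3"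
      using assms by (auto simp: B_def algebra_simps)
    also have "\<dots> \<le> exp (- (M * \<bar>x - c\<bar> ^ 3) / \<tau>)"
      using exp_ge_add_one_self[of "- (M * \<bar>x - c\<bar> ^ 3) / \<tau>"] by simp
    finally have "exp (- (k / 2 * (x - c)\<^sup>2) / \<tau>) * (1 - B * \<bar>x - c\<bar> ^ 3)
        \<le> exp (- (k / 2 * (x - c)\<^sup>2) / \<tau>) * exp (- (M * \<bar>x - c\<bar> ^ 3) / \<tau>)"
      by (intro mult_left_mono) auto
    also have "\<dots> = exp (- (k / 2 * (x - c)\<^sup>2 + M * \<bar>x - c\<bar> ^ 3) / \<tau>)"
      by (simp add: exp_add[symmetric] diff_divide_distrib)
    also have "\<dots> \<le> exp (- h x / \<tau>)"
      using divide_right_mono[OF le[OF True], of \<tau>] \<tau>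
      unfolding exp_le_cancel_iff minus_divide_left[symmetric] by simp
    finally show ?thesis
      using True unfolding n[symmetric] by (auto simp: algebra_simps abs_le_iff)
  next
    case False
    have "1 \<le> (\<bar>x - c\<bar> / r) ^ 3"
      using False assms by (intro one_le_power) auto
    also have "\<dots> \<le> B * \<bar>x - c\<bar> ^ 3"
      using \<tau> assms by (simp add: B_def field_simps)
    finally have "sqrt (2 * pi * \<sigma>\<^sup>2) * ?n x * (1 - B * \<bar>x - c\<bar> ^ 3) \<le> 0"
      by (intro mult_nonneg_nonpos) auto
    also have "0 \<le> indicator {c - r..c + r} x * exp (- h x / \<tau>)"
      by auto
    finally show ?thesis
      by (simp add: algebra_simps)
  qed
  \<comment> \<open>\<open>\<sigma> ^ 3\<close> is of order \<open>\<tau> * sqrt \<tau>\<close>. One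
    factor \<open>\<tau>\<close> cancels the \<open>1 / \<tau>\<close> in \<open>B\<close>, and
    \<open>\<tau> \<le> 1\<close> controls the summand \<open>1 / r ^ 3\<close>; a relative error of
    order \<open>sqrt \<tau>\<close> remains.\<close>
  have "B * \<sigma> ^ 3 \<le> (M + 1 / r ^ 3) * sqrt (1 / k) ^ 3 * sqrt \<tau>"
  proof -
    have "\<sigma> ^ 3 = sqrt (1 / k) ^ 3 * (\<tau> * sqrt \<tau>)"
      using \<tau> unfolding \<sigma>_def
      by (simp add: real_sqrt_divide power_divide power3_eq_cube)
    then have "B * \<sigma> ^ 3 = (B * \<tau>) * sqrt (1 / k) ^ 3 * sqrt \<tau>"
      by simp
    moreover have "B * \<tau> \<le> M + 1 / r ^ 3"
      using \<tau> assms by (simp add: B_def field_simps)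
    ultimately show ?thesis
      using assms \<tau> by (auto intro!: mult_right_mono)
  qed
  from mult_right_mono[OF this, of "2 * sqrt (2 / pi)"]
  have "B * (2 * \<sigma> ^ 3 * sqrt (2 / pi))
      \<le> (M + 1 / r ^ 3) * (2 * sqrt (1 / k) ^ 3 * sqrt (2 / pi)) * sqrt \<tau>"
    by (simp add: mult_ac)
  then have "sqrt (2 * pi * \<tau> / k)
        * (1 - (M + 1 / r ^ 3) * (2 * sqrt (1 / k) ^ 3 * sqrt (2 / pi)) * sqrt \<tau>)
      \<le> sqrt (2 * pi * \<sigma>\<^sup>2) * (1 - B * (2 * \<sigma> ^ 3 * sqrt (2 / pi)))"
    unfolding \<sigma>(2) times_divide_eq_right using \<tau> assms by (intro mult_left_mono) auto
  also have "\<dots> = (\<integral>x. sqrt (2 * pi * \<sigma>\<^sup>2) * (?n x - B * (?n x * \<bar>x - c\<bar> ^ 3)) \<partial>lborel)"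
    using moment \<sigma>(1) by simp
  also have "\<dots> \<le> (\<integral>x. indicator {c - r..c + r} x * exp (- h x / \<tau>) \<partial>lborel)"
  proof (intro integral_mono pt)
    show "integrable lborel (\<lambda>x. indicator {c - r..c + r} x * exp (- h x / \<tau>))"
    proof -
      have "continuous_on {c - r..c + r} (\<lambda>x. exp (- h x / \<tau>))"
        using cont \<tau> by (intro continuous_intros) auto
      then show ?thesis
        using borel_integrable_compact[OF compact_Icc] by fastforce
    qed
  qed (use moment \<sigma>(1) in auto)
  finally show "sqrt (2 * pi * \<tau> / k)
        * (1 - (M + 1 / r ^ 3) * (2 * sqrt (1 / k) ^ 3 * sqrt (2 / pi)) * sqrt \<tau>)
      \<le> (\<integral>x. indicator {c - r..c + r} x * exp (- h x / \<tau>) \<partial>lborel)" .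
qed (use assms in auto)

lemma laplace_lower_bound_at:
  fixes f :: "real \<Rightarrow> real"
  assumes "0 < k" "0 < r" "0 \<le> M"
    and cont: "continuous_on {c - r..c + r} f"
    and le: "\<And>x. \<bar>x - c\<bar> \<le> r \<Longrightarrow> f x \<le> f c + k / 2 * (x - c)\<^sup>2 + M * \<bar>x - c\<bar> ^ 3"
  obtains C where "C \<ge> 0" and "\<And>\<tau>. 0 < \<tau> \<Longrightarrow> \<tau> \<le> 1 \<Longrightarrow>
    exp (- f c / \<tau>) * (sqrt (2 * pi * \<tau> / k) * (1 - C * sqrt \<tau>))
      \<le> (\<integral>x. indicator {c - r..c + r} x * exp (- f x / \<tau>) \<partial>lborel)"
proof -
  have cont_diff: "continuous_on {c - r..c + r} (\<lambda>x. f x - f c)"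
    using cont by (intro continuous_intros)
  have le_diff: "f x - f c \<le> k / 2 * (x - c)\<^sup>2 + M * \<bar>x - c\<bar> ^ 3" if "\<bar>x - c\<bar> \<le> r" for x
    using le[OF that] by simp
  obtain C where C: "C \<ge> 0" "\<And>\<tau>. 0 < \<tau> \<Longrightarrow> \<tau> \<le> 1 \<Longrightarrow>
    sqrt (2 * pi * \<tau> / k) * (1 - C * sqrt \<tau>)
      \<le> (\<integral>x. indicator {c - r..c + r} x * exp (- (f x - f c) / \<tau>) \<partial>lborel)"
    using laplace_lower_bound[OF assms(1-3) cont_diff le_diff] by blast
  show ?thesis
  proof (rule that[OF C(1)])
    fix \<tau> :: real assume \<tau>: "0 < \<tau>" "\<tau> \<le> 1"
    have eq: "indicator {c - r..c + r} x * exp (- f x / \<tau>)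
        = exp (- f c / \<tau>) * (indicator {c - r..c + r} x * exp (- (f x - f c) / \<tau>))" for x
      by (simp add: indicator_def exp_add[symmetric] diff_divide_distrib)
    show "exp (- f c / \<tau>) * (sqrt (2 * pi * \<tau> / k) * (1 - C * sqrt \<tau>))
        \<le> (\<integral>x. indicator {c - r..c + r} x * exp (- f x / \<tau>) \<partial>lborel)"
      unfolding eq integral_mult_right_zero using C(2)[OF \<tau>] by (intro mult_left_mono) auto
  qed
qed

text \<open>The sign \<open>e\<close> serves wells and barrier alike: \<open>e = 1\<close> treats
  \<open>exp (- H / \<tau>)\<close> at a minimum, \<open>e = -1\<close> treats
  \<open>exp (H / \<tau>)\<close> at a maximum. The linear Taylor term vanishes at a critical
  point.\<close>

lemma laplace_lower_bound_critical:
  fixes H :: "real \<Rightarrow> real"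
  assumes "C_k 3 H" "deriv H c = 0" "0 < e * deriv (deriv H) c" "0 < r"
  obtains C where "C \<ge> 0" and "\<And>\<tau>. 0 < \<tau> \<Longrightarrow> \<tau> \<le> 1 \<Longrightarrow>
    exp (- (e * H c) / \<tau>) * (sqrt (2 * pi * \<tau> / (e * deriv (deriv H) c)) * (1 - C * sqrt \<tau>))
      \<le> (\<integral>x. indicator {c - r..c + r} x * exp (- (e * H x) / \<tau>) \<partial>lborel)"
proof -
  obtain M where M: "M \<ge> 0" "\<And>x. \<bar>x - c\<bar> \<le> r \<Longrightarrow>
    \<bar>H x - H c - deriv H c * (x - c) - deriv (deriv H) c / 2 * (x - c)\<^sup>2\<bar> \<le> M * \<bar>x - c\<bar> ^ 3"
    using taylor_second_order[OF assms(1,4)] by blast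
  have "continuous_on UNIV H"
    by (meson C_3_real(1)[OF assms(1)] DERIV_continuous continuous_at_imp_continuous_on)
  then have cont: "continuous_on {c - r..c + r} (\<lambda>x. e * H x)"
    by (intro continuous_on_mult continuous_on_const) (rule continuous_on_subset, auto)
  have le: "e * H x \<le> e * H c + e * deriv (deriv H) c / 2 * (x - c)\<^sup>2 + \<bar>e\<bar> * M * \<bar>x - c\<bar> ^ 3"
    if "\<bar>x - c\<bar> \<le> r" for x
  proof -
    have "e * (H x - H c - deriv (deriv H) c / 2 * (x - c)\<^sup>2)
        \<le> \<bar>e\<bar> * \<bar>H x - H c - deriv (deriv H) c / 2 * (x - c)\<^sup>2\<bar>"
      unfolding abs_mult[symmetric] by (rule abs_ge_self)
    also have "\<dots> \<le> \<bar>e\<bar> * (M * \<bar>x - c\<bar> ^ 3)"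
      using M(2)[OF that] assms(2) by (intro mult_left_mono) auto
    finally show ?thesis
      by (simp add: algebra_simps)
  qed
  have "0 \<le> \<bar>e\<bar> * M"
    using M(1) by simp
  from laplace_lower_bound_at[OF assms(3,4) this cont le] that show ?thesis
    by blast
qed

section \<open>The shape of the potential\<close>

text \<open>If \<open>l\<close> were negative, \<open>f'\<close> would be negative just to the right
  of \<open>x\<close>, and \<open>f\<close> would drop strictly below \<open>f x\<close>
  there.\<close>

lemma local_min_deriv2_nonneg:
  fixes f :: "real \<Rightarrow> real"
  assumes "local_min f x" and D: "\<And>x. (f has_real_derivative f' x) (at x)"
    and D2: "(f' has_real_derivative l) (at x)" and "f' x = 0"
  shows "0 \<le> l"
proof (rule ccontr)
  assume "\<not> 0 \<le> l"
  then obtain d where d: "d > 0" "\<And>h. 0 < h \<Longrightarrow> h < d \<Longrightarrow> f' (x + h) < 0"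
    using DERIV_neg_dec_right[OF D2] assms(4) by auto
  obtain e where e: "e > 0" "\<And>y. dist y x < e \<Longrightarrow> f x \<le> f y"
    using assms(1) unfolding local_min_def eventually_nhds_metric by auto
  define h where "h = min d e / 2"
  have h: "0 < h" "h < d" "h < e"
    using d(1) e(1) by (auto simp: h_def)
  have "f x > f (x + h)"
  proof (rule DERIV_neg_imp_decreasing_open[of x "x + h" f])
    show "\<exists>y. (f has_real_derivative y) (at t) \<and> y < 0" if "x < t" "t < x + h" for t
      using d(2)[of "t - x"] D[of t] that h by auto
    show "continuous_on {x..x + h} f"
      by (meson D DERIV_continuous continuous_at_imp_continuous_on)
  qed (use h in auto)
  moreover have "f x \<le> f (x + h)"
    using e(2)[of "x + h"] h by (auto simp: dist_real_def)
  ultimately show False by simp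
qed

text \<open>Beyond \<open>s\<close> the only zero of \<open>deriv H\<close> is
  \<open>m\<^sub>2\<close>, so \<open>deriv H\<close> keeps its sign on each side of
  \<open>m\<^sub>2\<close>, and the curvatures at \<open>s\<close> and \<open>m\<^sub>2\<close> fix
  these signs. Thus \<open>H\<close> falls from \<open>s\<close> to \<open>m\<^sub>2\<close> and
  rises afterwards; continuity at \<open>s\<close> extends the lower bound a little to the
  left.\<close>

lemma double_well_geometry:
  fixes H :: "real \<Rightarrow> real"
  assumes C3: "C_k 3 H" and morse: "\<And>x. deriv H x = 0 \<Longrightarrow> deriv (deriv H) x \<noteq> 0"
    and crit: "\<And>x. deriv H x = 0 \<longleftrightarrow> x \<in> {m\<^sub>1, s, m\<^sub>2}" and order: "m\<^sub>1 < s" "s < m\<^sub>2"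
    and extrema: "local_min H m\<^sub>1" "local_min H m\<^sub>2" "local_max H s"
  shows "0 < deriv (deriv H) m\<^sub>1" and "0 < deriv (deriv H) m\<^sub>2" and "deriv (deriv H) s < 0"
    and "H m\<^sub>2 < H s" and "\<exists>r>0. s + r < m\<^sub>2 \<and> (\<forall>x\<ge>s - r. H m\<^sub>2 \<le> H x)"
proof -
  note D = C_3_real[OF C3]
  have cont: "continuous_on S H" for S
    by (meson D(1) DERIV_continuous continuous_at_imp_continuous_on)
  have cont': "continuous_on S (deriv H)" for S
    by (meson D(2) DERIV_continuous continuous_at_imp_continuous_on)
  show "0 < deriv (deriv H) m\<^sub>1"
    using local_min_deriv2_nonneg[OF extrema(1) D(1) D(2)] crit[of m\<^sub>1] morse[of m\<^sub>1] by simp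
  show m2: "0 < deriv (deriv H) m\<^sub>2"
    using local_min_deriv2_nonneg[OF extrema(2) D(1) D(2)] crit[of m\<^sub>2] morse[of m\<^sub>2] by simp
  have "local_min (\<lambda>x. - H x) s"
    using extrema(3) by (simp add: local_min_def local_max_def)
  then have "0 \<le> - deriv (deriv H) s"
    by (rule local_min_deriv2_nonneg[OF _ DERIV_minus[OF D(1)] DERIV_minus[OF D(2)]])
       (use crit[of s] in simp)
  then show s: "deriv (deriv H) s < 0"
    using crit[of s] morse[of s] by simp
  \<comment> \<open>A sign change would produce, by the intermediate value theorem, a zero of
    \<open>deriv H\<close> in \<open>{x..y}\<close>; the last premise keeps \<open>m\<^sub>2\<close>
    out of that interval.\<close>
  have same_sign: "False" if xy: "s < x" "x < y" "deriv H x * deriv H y < 0" "y < m\<^sub>2 \<or> m\<^sub>2 < x" for x y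
  proof -
    have con: "connected (deriv H ` {x..y})"
      by (intro connected_continuous_image cont' connected_Icc)
    have im: "deriv H x \<in> deriv H ` {x..y}" "deriv H y \<in> deriv H ` {x..y}"
      using xy by auto
    consider "deriv H x < 0" "0 < deriv H y" | "deriv H y < 0" "0 < deriv H x"
      using xy(3) unfolding mult_less_0_iff by blast
    then have "0 \<in> deriv H ` {x..y}"
      by cases (use connectedD_interval[OF con im] connectedD_interval[OF con im(2,1)] in auto)
    then obtain z where "z \<in> {x..y}" "deriv H z = 0"
      by auto
    then show False
      using crit[of z] xy order by auto
  qed
  \<comment> \<open>The negative curvature at \<open>s\<close> supplies a point between
    \<open>s\<close> and \<open>x\<close> with negative derivative, so a positive value at
    \<open>x\<close> contradicts \<open>same_sign\<close>. The argument to the right of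
    \<open>m\<^sub>2\<close> is the mirror image.\<close>
  have neg: "deriv H x < 0" if x: "s < x" "x < m\<^sub>2" for x
  proof (rule ccontr)
    assume "\<not> deriv H x < 0"
    then have pos: "0 < deriv H x"
      using crit[of x] x order by auto
    obtain d where d: "d > 0" "\<And>h. 0 < h \<Longrightarrow> h < d \<Longrightarrow> deriv H (s + h) < 0"
      using DERIV_neg_dec_right[OF D(2) s] crit[of s] by auto
    define h where "h = min d (x - s) / 2"
    have h: "0 < h" "h < d" "h < x - s"
      using d(1) x by (auto simp: h_def)
    show False
      using same_sign[of "s + h" x] h d(2)[of h] pos x by (auto intro: mult_neg_pos)
  qed
  have pos: "0 < deriv H x" if x: "m\<^sub>2 < x" for x
  proof (rule ccontr)
    assume "\<not> 0 < deriv H x"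
    then have neg: "deriv H x < 0"
      using crit[of x] x order by auto
    obtain d where d: "d > 0" "\<And>h. 0 < h \<Longrightarrow> h < d \<Longrightarrow> 0 < deriv H (m\<^sub>2 + h)"
      using DERIV_pos_inc_right[OF D(2) m2] crit[of m\<^sub>2] by auto
    define h where "h = min d (x - m\<^sub>2) / 2"
    have h: "0 < h" "h < d" "h < x - m\<^sub>2"
      using d(1) x by (auto simp: h_def)
    show False
      using same_sign[of "m\<^sub>2 + h" x] h d(2)[of h] neg x order by (auto intro: mult_pos_neg)
  qed
  have left: "H m\<^sub>2 < H x" if "s \<le> x" "x < m\<^sub>2" for x
  proof (rule DERIV_neg_imp_decreasing_open[OF that(2) _ cont])
    show "\<exists>z. (H has_real_derivative z) (at y) \<and> z < 0" if "x < y" "y < m\<^sub>2" for y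
      using D(1)[of y] neg[of y] that \<open>s \<le> x\<close> by (intro exI[of _ "deriv H y"]) simp
  qed
  have right: "H m\<^sub>2 < H x" if "m\<^sub>2 < x" for x
  proof (rule DERIV_pos_imp_increasing_open[OF that _ cont])
    show "\<exists>z. (H has_real_derivative z) (at y) \<and> 0 < z" if "m\<^sub>2 < y" "y < x" for y
      using D(1)[of y] pos[of y] that by (intro exI[of _ "deriv H y"]) simp
  qed
  show barrier: "H m\<^sub>2 < H s"
    using left order by simp
  have "(H \<longlongrightarrow> H s) (nhds s)"
    using DERIV_isCont[OF D(1)] unfolding isCont_def tendsto_at_iff_tendsto_nhds .
  then have "\<forall>\<^sub>F x in nhds s. H m\<^sub>2 < H x"
    using barrier by (rule order_tendstoD)
  then obtain d where d: "d > 0" "\<And>x. \<bar>x - s\<bar> < d \<Longrightarrow> H m\<^sub>2 < H x"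
    unfolding eventually_nhds_metric dist_real_def by auto
  \<comment> \<open>Halving makes \<open>s + r < m\<^sub>2\<close> strict and keeps
    \<open>{s - r..s}\<close> inside the neighbourhood where \<open>H\<close> exceeds
    \<open>H m\<^sub>2\<close>.\<close>
  define r where "r = min d (m\<^sub>2 - s) / 2"
  have r: "0 < r" "r < d" "s + r < m\<^sub>2"
    using d(1) order by (auto simp: r_def min_def field_simps)
  have "H m\<^sub>2 \<le> H x" if "x \<ge> s - r" for x
  proof -
    consider "x < s" | "s \<le> x" "x < m\<^sub>2" | "x = m\<^sub>2" | "m\<^sub>2 < x"
      by linarith
    then show ?thesis
    proof cases
      case 1
      then show ?thesis
        using d(2)[of x] that r by auto
    qed (use left[of x] right[of x] in auto)
  qed
  then show "\<exists>r>0. s + r < m\<^sub>2 \<and> (\<forall>x\<ge>s - r. H m\<^sub>2 \<le> H x)"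
    using r by blast
qed

section \<open>Linear growth and integrability of the Gibbs weights\<close>

text \<open>\<open>f'\<close> has no zero beyond \<open>R\<close>, so by connectedness it stays
  above \<open>c\<close> or below \<open>- c\<close>. The second option would drive \<open>f\<close>
  below zero; the first gives the bound by the mean value theorem.\<close>

lemma linear_growth_right:
  fixes f :: "real \<Rightarrow> real"
  assumes D: "\<And>x. (f has_real_derivative f' x) (at x)"
    and cont: "continuous_on UNIV f'" and nonneg: "\<And>x. 0 \<le> f x"
    and "0 < c" and big: "\<And>x. x \<ge> R \<Longrightarrow> c \<le> \<bar>f' x\<bar>" and "x \<ge> R"
  shows "c * (x - R) \<le> f x"
proof -
  have cf: "continuous_on S f" for S
    by (meson D DERIV_continuous continuous_at_imp_continuous_on)
  have "connected (f' ` {R..})"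
    by (intro connected_continuous_image continuous_on_subset[OF cont]) auto
  then have sign: "(\<forall>x\<ge>R. c \<le> f' x) \<or> (\<forall>x\<ge>R. f' x \<le> - c)"
  proof -
    assume con: "connected (f' ` {R..})"
    show ?thesis
    proof (rule ccontr)
      assume "\<not> ?thesis"
      then obtain y z where yz: "y \<ge> R" "\<not> c \<le> f' y" "z \<ge> R" "\<not> f' z \<le> - c"
        by blast
      then have "f' y \<le> 0" "0 \<le> f' z"
        using big[of y] big[of z] \<open>0 < c\<close> by auto
      then have "0 \<in> f' ` {R..}"
        using con yz unfolding connected_iff_interval by (metis atLeast_iff imageI)
      then show False
        using big \<open>0 < c\<close> by force
    qed
  qed
  have mvt: "\<exists>t. R < t \<and> t < y \<and> f y - f R = (y - R) * f' t" if "R < y" for y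
    using MVT2[OF that, of f f'] D by auto
  show ?thesis
    using sign
  proof
    assume up: "\<forall>x\<ge>R. c \<le> f' x"
    show ?thesis
    proof (cases "x = R")
      case False
      then obtain t where t: "R < t" "f x - f R = (x - R) * f' t"
        using mvt[of x] assms(6) by auto
      have "(x - R) * c \<le> (x - R) * f' t"
        using up t assms(6) by (intro mult_left_mono) auto
      then show ?thesis
        using t nonneg[of R] by (simp add: mult.commute)
    qed (use nonneg in auto)
  next
    assume down: "\<forall>x\<ge>R. f' x \<le> - c"
    \<comment> \<open>With slope at most \<open>- c\<close>, the value \<open>f R\<close> has fallen
      to \<open>- 1\<close> or lower at this point.\<close>
    define y where "y = R + (f R + 1) / c"
    have y: "R < y"
      using nonneg[of R] \<open>0 < c\<close> by (simp add: y_def add_nonneg_pos)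
    then obtain t where t: "R < t" "f y - f R = (y - R) * f' t"
      using mvt by blast
    have "(y - R) * f' t \<le> (y - R) * (- c)"
      using down t y by (intro mult_left_mono) auto
    also have "\<dots> = - (f R + 1)"
      using \<open>0 < c\<close> by (simp add: y_def)
    finally have "f y < 0"
      using t by simp
    then show ?thesis
      using nonneg[of y] by simp
  qed
qed

text \<open>Outside a compact set the slope is bounded away from zero; the one-sided estimate is
  applied to \<open>H\<close> and to its reflection \<open>\<lambda>x. H (- x)\<close>.\<close>

lemma growth_PI_linear_growth:
  assumes "growth_PI H"
  obtains c L where "0 < c" "\<And>x. c * \<bar>x\<bar> - L \<le> H x"
proof -
  have C3: "C_k 3 H" and nonneg: "\<And>x. 0 \<le> H x"
    using assms by (auto simp: growth_PI_def)
  note D = C_3_real[OF C3]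
  obtain C where C: "C > 0" "Liminf at_infinity (\<lambda>x. ereal \<bar>deriv H x\<bar>) \<ge> ereal C"
    using assms by (auto simp: growth_PI_def)
  \<comment> \<open>A lower limit of at least \<open>C\<close> guarantees eventual values above any
    smaller constant, here \<open>C / 2\<close>.\<close>
  then have "\<forall>\<^sub>F x in at_infinity. ereal (C / 2) < ereal \<bar>deriv H x\<bar>"
    unfolding le_Liminf_iff by (auto dest!: spec[of _ "ereal (C / 2)"])
  then obtain R0 where R0: "\<And>x. R0 \<le> \<bar>x\<bar> \<Longrightarrow> C / 2 < \<bar>deriv H x\<bar>"
    by (auto simp: eventually_at_infinity)
  define R where "R = max 0 R0"
  have R: "0 \<le> R" "\<And>x. R \<le> \<bar>x\<bar> \<Longrightarrow> C / 2 \<le> \<bar>deriv H x\<bar>"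
    using R0 by (auto simp: R_def less_imp_le)
  have cont: "continuous_on S (deriv H)" for S
    by (meson D DERIV_continuous continuous_at_imp_continuous_on)
  have right: "C / 2 * (x - R) \<le> H x" if "x \<ge> R" for x
    using linear_growth_right[of H "deriv H" "C / 2" R x] D cont nonneg C R that by auto
  have left: "C / 2 * (- x - R) \<le> H x" if "- x \<ge> R" for x
  proof -
    have "((\<lambda>x. H (- x)) has_real_derivative - deriv H (- x)) (at x)" for x
      using DERIV_chain2[of H "deriv H (- x)" uminus x "- 1"] D(1)
      by (auto intro!: DERIV_minus[OF DERIV_ident])
    moreover have "continuous_on UNIV (\<lambda>x. - deriv H (- x))"
      by (intro continuous_intros continuous_on_compose2[OF cont[of UNIV]]) auto
    ultimately show ?thesis
      using linear_growth_right[of "\<lambda>x. H (- x)" "\<lambda>x. - deriv H (- x)" "C / 2" R "- x"]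
        nonneg C R that by auto
  qed
  show ?thesis
  proof (rule that[of "C / 2" "C / 2 * R"])
    fix x
    consider "R \<le> x" | "R \<le> - x" | "\<bar>x\<bar> < R"
      by linarith
    then show "C / 2 * \<bar>x\<bar> - C / 2 * R \<le> H x"
    proof cases
      case 3
      then have "C / 2 * (\<bar>x\<bar> - R) \<le> 0"
        using C by (intro mult_nonneg_nonpos) auto
      then show ?thesis
        using nonneg[of x] by (simp add: algebra_simps)
    qed (use right[of x] left[of x] R in \<open>auto simp: algebra_simps\<close>)
  qed (use C in auto)
qed

text \<open>The bound \<open>exp y \<ge> 1 + y + y\<^sup>2 / 2\<close> at
  \<open>y = c * \<bar>x\<bar>\<close> allows comparison with the integrable function
  \<open>1 / (1 + x\<^sup>2)\<close>.\<close>

lemma integrable_exp_neg_abs: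
  fixes c :: real
  assumes "0 < c"
  shows "integrable lborel (\<lambda>x::real. exp (- c * \<bar>x\<bar>))"
proof -
  have "integrable lborel (\<lambda>x::real. inverse (1 + x\<^sup>2))"
    using integrable_inverse_1_plus_square by (simp add: set_integrable_def)
  then have "integrable lborel (\<lambda>x::real. (1 + 2 / c\<^sup>2) * inverse (1 + x\<^sup>2))"
    by (rule integrable_mult_right)
  then show ?thesis
  proof (rule Bochner_Integration.integrable_bound)
    have "exp (- c * \<bar>x\<bar>) \<le> (1 + 2 / c\<^sup>2) * inverse (1 + x\<^sup>2)" for x
    proof -
      \<comment> \<open>The products \<open>1 * 1\<close> and
        \<open>2 / c\<^sup>2 * ((c * \<bar>x\<bar>)\<^sup>2 / 2)\<close> already give the left-hand
        side; all others are nonnegative.\<close>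
      have "1 + x\<^sup>2 \<le> (1 + 2 / c\<^sup>2) * (1 + c * \<bar>x\<bar> + (c * \<bar>x\<bar>)\<^sup>2 / 2)"
        using assms by (simp add: field_simps power2_eq_square)
      also have "\<dots> \<le> (1 + 2 / c\<^sup>2) * exp (c * \<bar>x\<bar>)"
        using assms by (intro mult_left_mono exp_lower_Taylor_quadratic) auto
      finally show ?thesis
        by (simp add: exp_minus divide_inverse[symmetric] field_simps add_pos_nonneg)
    qed
    then show "AE x in lborel. norm (exp (- c * \<bar>x\<bar>)) \<le> norm ((1 + 2 / c\<^sup>2) * inverse (1 + x\<^sup>2))"
      by (intro AE_I2) (simp add: order_trans[OF _ abs_ge_self])
  qed auto
qed

lemma growth_PI_integrable:
  assumes "growth_PI H" "0 < \<tau>"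
  shows "integrable lborel (\<lambda>x. exp (- H x / \<tau>))"
proof -
  obtain c L where cL: "0 < c" "\<And>x. c * \<bar>x\<bar> - L \<le> H x"
    using growth_PI_linear_growth[OF assms(1)] by blast
  have "C_k 3 H"
    using assms by (auto simp: growth_PI_def)
  then have "continuous_on UNIV H"
    by (meson C_3_real(1) DERIV_continuous continuous_at_imp_continuous_on)
  then have [measurable]: "H \<in> borel_measurable borel"
    by (rule borel_measurable_continuous_onI)
  have "integrable lborel (\<lambda>x::real. exp (L / \<tau>) * exp (- (c / \<tau>) * \<bar>x\<bar>))"
    using cL assms by (intro integrable_mult_right integrable_exp_neg_abs) auto
  then show ?thesis
  proof (rule Bochner_Integration.integrable_bound)
    have "exp (- H x / \<tau>) \<le> exp (L / \<tau>) * exp (- (c / \<tau>) * \<bar>x\<bar>)" for x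
      using cL(2)[of x] assms(2) unfolding exp_add[symmetric] exp_le_cancel_iff
      by (simp add: field_simps)
    then show "AE x in lborel. norm (exp (- H x / \<tau>))
        \<le> norm (exp (L / \<tau>) * exp (- (c / \<tau>) * \<bar>x\<bar>))"
      by auto
  qed simp
qed

section \<open>Test functions of one coordinate\<close>

lemma integrable_continuous_compact_support:
  fixes F :: "'a::euclidean_space \<Rightarrow> real"
  assumes "continuous_on UNIV F" "compact K" "\<And>x. x \<notin> K \<Longrightarrow> F x = 0"
  shows "integrable lborel F"
proof -
  have "integrable lborel (\<lambda>x. indicator K x *\<^sub>R F x)"
    using assms(2) continuous_on_subset[OF assms(1) subset_UNIV] by (rule borel_integrable_compact)
  moreover have "(\<lambda>x. indicator K x *\<^sub>R F x) = F"
    using assms(3) by (force simp: indicator_def fun_eq_iff)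
  ultimately show ?thesis
    by simp
qed

lemma test_function_properties:
  fixes \<phi> :: "'a::euclidean_space \<Rightarrow> real"
  assumes "test_function \<phi>"
  shows "\<phi> differentiable (at x)" and "continuous_on UNIV \<phi>"
    and "b \<in> Basis \<Longrightarrow> continuous_on UNIV (\<lambda>x. frechet_derivative \<phi> (at x) b)"
    and "x \<notin> closure {x. \<phi> x \<noteq> 0} \<Longrightarrow> frechet_derivative \<phi> (at x) b = 0"
proof -
  have C: "C_k k \<phi>" for k
    using assms by (simp add: test_function_def)
  show "\<phi> differentiable (at x)" "continuous_on UNIV \<phi>"
      "b \<in> Basis \<Longrightarrow> continuous_on UNIV (\<lambda>x. frechet_derivative \<phi> (at x) b)"
    using C[of 0] C[of "Suc 0"] by auto
  assume x: "x \<notin> closure {x. \<phi> x \<noteq> 0}"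
  have "(\<phi> has_derivative (\<lambda>_. 0)) (at x)"
  proof (rule has_derivative_transform_within_open)
    show "((\<lambda>_. 0) has_derivative (\<lambda>_. 0)) (at x)"
      by simp
    show "open (- closure {x. \<phi> x \<noteq> 0})"
      by (intro open_Compl closed_closure)
    show "0 = \<phi> y" if "y \<in> - closure {x. \<phi> x \<noteq> 0}" for y
      using that closure_subset[of "{x. \<phi> x \<noteq> 0}"] by auto
  qed (use x in auto)
  then show "frechet_derivative \<phi> (at x) b = 0"
    by (metis frechet_derivative_at)
qed

text \<open>The fundamental theorem is applied to \<open>G * \<psi>\<close> on
  \<open>{- L..L}\<close>, where the boundary terms vanish. The finite set \<open>S\<close> admits
  corners of \<open>G\<close>, as they occur for a primitive clamped to an interval.\<close>

lemma integral_by_parts_piecewise: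
  fixes G w \<psi> \<psi>' :: "real \<Rightarrow> real"
  assumes S: "finite S" "\<And>x. x \<notin> S \<Longrightarrow> (G has_real_derivative w x) (at x)"
    and G: "continuous_on UNIV G"
    and w: "w \<in> borel_measurable borel" "\<And>x. \<bar>w x\<bar> \<le> B"
    and \<psi>: "\<And>x. (\<psi> has_real_derivative \<psi>' x) (at x)" "continuous_on UNIV \<psi>'"
    and L: "\<And>x. L \<le> \<bar>x\<bar> \<Longrightarrow> \<psi> x = 0" "\<And>x. L \<le> \<bar>x\<bar> \<Longrightarrow> \<psi>' x = 0" "0 < L"
  shows "(\<integral>x. G x * \<psi>' x \<partial>lborel) = - (\<integral>x. w x * \<psi> x \<partial>lborel)"
proof -
  note [measurable] = w(1)
  have c\<psi>: "continuous_on UNIV \<psi>"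
    by (meson \<psi>(1) DERIV_continuous continuous_at_imp_continuous_on)
  have zero: "\<psi> x = 0" "\<psi>' x = 0" if "x \<notin> {- L..L}" for x
    using L(1,2)[of x] that by auto
  have i1: "integrable lborel (\<lambda>x. G x * \<psi>' x)"
    using continuous_on_mult[OF G \<psi>(2)] compact_Icc[of "- L" L]
    by (rule integrable_continuous_compact_support) (simp add: zero)
  have i\<psi>: "integrable lborel \<psi>"
    using c\<psi> compact_Icc[of "- L" L] zero(1) by (rule integrable_continuous_compact_support)
  have i2: "integrable lborel (\<lambda>x. w x * \<psi> x)"
  proof (rule Bochner_Integration.integrable_bound)
    show "integrable lborel (\<lambda>x. B * \<psi> x)"
      using i\<psi> by simp
    have "\<bar>w x\<bar> * \<bar>\<psi> x\<bar> \<le> \<bar>B\<bar> * \<bar>\<psi> x\<bar>" for x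
      using w(2)[of x] by (intro mult_right_mono) auto
    then show "AE x in lborel. norm (w x * \<psi> x) \<le> norm (B * \<psi> x)"
      by (simp add: abs_mult)
  qed (use i\<psi> in measurable)
  let ?h = "\<lambda>x. w x * \<psi> x + G x * \<psi>' x"
  have "(?h has_integral (G L * \<psi> L - G (- L) * \<psi> (- L))) {- L..L}"
  proof (rule fundamental_theorem_of_calculus_interior_strong[OF S(1)])
    fix x assume "x \<in> {- L<..<L} - S"
    then show "((\<lambda>x. G x * \<psi> x) has_vector_derivative ?h x) (at x)"
      using DERIV_mult[OF S(2)[of x] \<psi>(1)]
      by (simp add: has_real_derivative_iff_has_vector_derivative mult_ac add_ac)
  next
    show "continuous_on {- L..L} (\<lambda>x. G x * \<psi> x)"
      using continuous_on_subset[OF continuous_on_mult[OF G c\<psi>] subset_UNIV] .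
  qed (use L(3) in simp)
  then have "integral {- L..L} ?h = 0"
    using L(1)[of L] L(1)[of "- L"] by (simp add: integral_unique)
  \<comment> \<open>The integrand vanishes off \<open>{- L..L}\<close>, so the interval integral
    from the fundamental theorem is the Lebesgue integral over the whole line.\<close>
  moreover have ind: "(\<lambda>x. indicator {- L..L} x *\<^sub>R ?h x) = ?h"
  proof
    show "indicator {- L..L} x *\<^sub>R ?h x = ?h x" for x
      using zero[of x] by (cases "x \<in> {- L..L}") auto
  qed
  have "set_integrable lborel {- L..L} ?h"
    unfolding set_integrable_def ind using i2 i1 by (rule Bochner_Integration.integrable_add)
  then have "(LINT x:{- L..L}|lborel. ?h x) = integral {- L..L} ?h"
    by (rule set_borel_integral_eq_integral)
  ultimately have "(\<integral>x. ?h x \<partial>lborel) = 0"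
    unfolding set_lebesgue_integral_def ind by simp
  then show ?thesis
    using i1 i2 by simp
qed

text \<open>Fubini reduces the claim to slices. Along the first coordinate \<open>G\<close> is
  constant and the integral of the partial derivative vanishes; along the second it is
  one-dimensional integration by parts.\<close>

lemma has_weak_gradient_snd:
  fixes G w :: "real \<Rightarrow> real"
  assumes S: "finite S" "\<And>x. x \<notin> S \<Longrightarrow> (G has_real_derivative w x) (at x)"
    and G: "continuous_on UNIV G"
    and w: "w \<in> borel_measurable borel" "\<And>x. \<bar>w x\<bar> \<le> B"
  shows "(\<lambda>z::real \<times> real. G (snd z)) has_weak_gradient (\<lambda>z. (0, w (snd z)))"
  unfolding has_weak_gradient_def
proof (intro conjI allI impI ballI)
  note [measurable] = w(1)
  have cG: "continuous_on T (\<lambda>z::real \<times> real. G (snd z))" for T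
    by (intro continuous_on_compose2[OF G] continuous_intros) auto
  show "locally_integrable (\<lambda>z::real \<times> real. G (snd z))"
    unfolding locally_integrable_def set_integrable_def
    by (intro allI impI borel_integrable_compact cG)
  show "locally_integrable (\<lambda>z::real \<times> real. (0::real, w (snd z)))"
    unfolding locally_integrable_def set_integrable_def
  proof (intro allI impI)
    fix T :: "(real \<times> real) set" assume T: "compact T"
    then have [measurable]: "T \<in> sets (borel \<Otimes>\<^sub>M borel)"
      unfolding borel_prod by (rule borel_compact)
    have "integrable lborel (\<lambda>z. indicator T z *\<^sub>R B)"
      using T by (intro borel_integrable_compact) auto
    then have "integrable lborel (\<lambda>z. (0::real, indicator T z * w (snd z)))"
    proof (rule Bochner_Integration.integrable_bound)
      show "(\<lambda>z. (0::real, indicator T z * w (snd z))) \<in> borel_measurable lborel"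
      proof -
        have "(\<lambda>z. (0::real, indicator T z * w (snd z))) \<in> borel_measurable (borel \<Otimes>\<^sub>M borel)"
          by measurable
        then show ?thesis
          by (simp add: borel_prod)
      qed
      have "\<bar>w x\<bar> \<le> \<bar>B\<bar>" for x
        using w(2)[of x] by simp
      then show "AE z in lborel. norm (0::real, indicator T z * w (snd z))
          \<le> norm (indicator T z *\<^sub>R B)"
        by (intro AE_I2) (simp add: norm_Pair abs_mult mult_left_mono)
    qed
    then show "integrable lborel (\<lambda>z. indicator T z *\<^sub>R (0::real, w (snd z)))"
      by simp
  qed
  fix \<phi> :: "real \<times> real \<Rightarrow> real" and b :: "real \<times> real"
  assume \<phi>: "test_function \<phi>" and b: "b \<in> Basis"
  define K where "K = closure {x. \<phi> x \<noteq> 0}"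
  have K: "compact K"
    using \<phi> by (simp add: K_def test_function_def)
  then obtain L0 where L0: "\<And>z. z \<in> K \<Longrightarrow> norm z \<le> L0"
    by (meson compact_imp_bounded bounded_iff)
  \<comment> \<open>The added \<open>1\<close> puts every point with a coordinate of modulus at
    least \<open>L\<close> outside \<open>K\<close>, and ensures \<open>0 < L\<close>.\<close>
  define L where "L = max L0 0 + 1"
  note TF = test_function_properties[OF \<phi>, folded K_def]
  have out: "(x, y) \<notin> K" if "L \<le> \<bar>x\<bar> \<or> L \<le> \<bar>y\<bar>" for x y
  proof
    assume "(x, y) \<in> K"
    then have "\<bar>x\<bar> \<le> L0" "\<bar>y\<bar> \<le> L0"
      using L0[of "(x, y)"] norm_fst_le[of x y] norm_snd_le[where x=x and y=y] by auto
    then show False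
      using that by (auto simp: L_def)
  qed
  have zero: "\<phi> z = 0" if "z \<notin> K" for z
    using that closure_subset[of "{x. \<phi> x \<noteq> 0}"] by (auto simp: K_def)
  have der: "(\<phi> has_derivative frechet_derivative \<phi> (at z)) (at z)" for z
    using TF(1) by (simp add: frechet_derivative_works)
  have cD: "continuous_on UNIV (\<lambda>z. frechet_derivative \<phi> (at z) b)"
    using b by (rule TF(3))
  have i1: "integrable (lborel \<Otimes>\<^sub>M lborel) (\<lambda>z. G (snd z) * frechet_derivative \<phi> (at z) b)"
    unfolding lborel_prod
    using continuous_on_mult[OF cG cD] K
    by (rule integrable_continuous_compact_support) (simp add: TF(4))
  have i2: "integrable (lborel \<Otimes>\<^sub>M lborel) (\<lambda>z. w (snd z) * \<phi> z)"
  proof (rule Bochner_Integration.integrable_bound)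
    have i\<phi>: "integrable lborel \<phi>"
      using TF(2) K zero by (rule integrable_continuous_compact_support)
    then show "integrable (lborel \<Otimes>\<^sub>M lborel) (\<lambda>z. B * \<phi> z)"
      by (simp add: lborel_prod)
    have "\<bar>w x\<bar> * \<bar>\<phi> z\<bar> \<le> \<bar>B\<bar> * \<bar>\<phi> z\<bar>" for x z
      using w(2)[of x] by (intro mult_right_mono) auto
    then show "AE z in lborel \<Otimes>\<^sub>M lborel. norm (w (snd z) * \<phi> z) \<le> norm (B * \<phi> z)"
      by (simp add: abs_mult)
    have [measurable]: "\<phi> \<in> borel_measurable (borel \<Otimes>\<^sub>M borel)"
      using borel_measurable_continuous_onI[OF TF(2)] by (simp add: borel_prod)
    show "(\<lambda>z. w (snd z) * \<phi> z) \<in> borel_measurable (lborel \<Otimes>\<^sub>M lborel)"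
      by measurable
  qed
  consider "b = (1, 0)" | "b = (0, 1)"
    using b by (auto simp: Basis_prod_def)
  then show "(\<integral>z. G (snd z) * frechet_derivative \<phi> (at z) b \<partial>lborel)
      = - (\<integral>z. ((0, w (snd z)) \<bullet> b) * \<phi> z \<partial>lborel)"
  proof cases
    case 1
    have slice: "((\<lambda>x. \<phi> (x, y)) has_real_derivative frechet_derivative \<phi> (at (x, y)) (1, 0)) (at x)"
      for x y
    proof -
      have "((\<lambda>x. (x, y)) has_derivative (\<lambda>h. (h, 0))) (at x)"
        by (auto intro!: derivative_eq_intros)
      from diff_chain_at[OF this der]
      have "((\<lambda>x. \<phi> (x, y)) has_derivative (\<lambda>h. frechet_derivative \<phi> (at (x, y)) (h, 0))) (at x)"
        by (simp add: o_def)
      moreover have "(\<lambda>h. frechet_derivative \<phi> (at (x, y)) (h, 0))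
          = (*) (frechet_derivative \<phi> (at (x, y)) (1, 0))"
      proof
        show "frechet_derivative \<phi> (at (x, y)) (h, 0) = frechet_derivative \<phi> (at (x, y)) (1, 0) * h" for h
          using linear_scale[OF has_derivative_linear[OF der], of "(x, y)" h "(1, 0)"] by simp
      qed
      ultimately show ?thesis
        unfolding has_field_derivative_def by metis
    qed
    \<comment> \<open>Integration by parts against the constant \<open>G y\<close>, whose derivative
      is zero. The first coordinate has to be integrated first here, hence
      \<open>integral_snd\<close> below.\<close>
    have inner: "(\<integral>x. G y * frechet_derivative \<phi> (at (x, y)) b \<partial>lborel) = 0" for y
    proof -
      have "(\<integral>x. G y * frechet_derivative \<phi> (at (x, y)) b \<partial>lborel) = - (\<integral>x. 0 * \<phi> (x, y) \<partial>lborel)"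
      proof (rule integral_by_parts_piecewise[where S="{}" and B=0 and L=L])
        show "continuous_on UNIV (\<lambda>x. frechet_derivative \<phi> (at (x, y)) b)"
          by (intro continuous_on_compose2[OF cD] continuous_intros) auto
      qed (use slice 1 TF(4) zero out in \<open>auto simp: L_def\<close>)
      then show ?thesis
        by simp
    qed
    have "(\<integral>z. G (snd z) * frechet_derivative \<phi> (at z) b \<partial>(lborel \<Otimes>\<^sub>M lborel))
        = (\<integral>y. (\<integral>x. G y * frechet_derivative \<phi> (at (x, y)) b \<partial>lborel) \<partial>lborel)"
      using lborel_pair.integral_snd[of "\<lambda>x y. G y * frechet_derivative \<phi> (at (x, y)) b"] i1
      by (simp add: case_prod_unfold)
    then have "(\<integral>z. G (snd z) * frechet_derivative \<phi> (at z) b \<partial>lborel) = 0"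
      unfolding inner lborel_prod by simp
    then show ?thesis
      by (simp add: 1)
  next
    case 2
    have slice: "((\<lambda>y. \<phi> (x, y)) has_real_derivative frechet_derivative \<phi> (at (x, y)) (0, 1)) (at y)"
      for x y
    proof -
      have "((\<lambda>y. (x, y)) has_derivative (\<lambda>h. (0, h))) (at y)"
        by (auto intro!: derivative_eq_intros)
      from diff_chain_at[OF this der]
      have "((\<lambda>y. \<phi> (x, y)) has_derivative (\<lambda>h. frechet_derivative \<phi> (at (x, y)) (0, h))) (at y)"
        by (simp add: o_def)
      moreover have "(\<lambda>h. frechet_derivative \<phi> (at (x, y)) (0, h))
          = (*) (frechet_derivative \<phi> (at (x, y)) (0, 1))"
      proof
        show "frechet_derivative \<phi> (at (x, y)) (0, h) = frechet_derivative \<phi> (at (x, y)) (0, 1) * h" for h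
          using linear_scale[OF has_derivative_linear[OF der], of "(x, y)" h "(0, 1)"] by simp
      qed
      ultimately show ?thesis
        unfolding has_field_derivative_def by metis
    qed
    have *: "(\<integral>y. G y * frechet_derivative \<phi> (at (x, y)) b \<partial>lborel)
        = - (\<integral>y. w y * \<phi> (x, y) \<partial>lborel)" for x
    proof (rule integral_by_parts_piecewise[OF S G w, where L=L])
      show "continuous_on UNIV (\<lambda>y. frechet_derivative \<phi> (at (x, y)) b)"
        by (intro continuous_on_compose2[OF cD] continuous_intros) auto
    qed (use slice 2 TF(4) zero out in \<open>auto simp: L_def\<close>)
    have "(\<integral>z. G (snd z) * frechet_derivative \<phi> (at z) b \<partial>(lborel \<Otimes>\<^sub>M lborel))
        = (\<integral>x. (\<integral>y. G y * frechet_derivative \<phi> (at (x, y)) b \<partial>lborel) \<partial>lborel)"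
      using lborel_pair.integral_fst'[OF i1] by simp
    also have "\<dots> = - (\<integral>x. (\<integral>y. w y * \<phi> (x, y) \<partial>lborel) \<partial>lborel)"
      unfolding * by simp
    also have "(\<integral>x. (\<integral>y. w y * \<phi> (x, y) \<partial>lborel) \<partial>lborel)
        = (\<integral>z. w (snd z) * \<phi> z \<partial>(lborel \<Otimes>\<^sub>M lborel))"
      using lborel_pair.integral_fst'[OF i2] by simp
    finally show ?thesis
      using 2 by (simp add: lborel_prod)
  qed
qed

text \<open>\<open>G\<close> is the primitive of \<open>u\<close> evaluated at the argument clamped
  to \<open>{a..b}\<close>: constant outside, with possible corners only at \<open>a\<close> and
  \<open>b\<close>. The unit integral of \<open>u\<close> puts the upper plateau at
  \<open>1\<close>.\<close>

lemma clamped_primitive: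
  fixes u :: "real \<Rightarrow> real"
  assumes "a < b" and u: "continuous_on {a..b} u"
    and one: "(\<integral>x. indicator {a..b} x * u x \<partial>lborel) = 1"
  obtains G where "continuous_on UNIV G"
    and "\<And>x. x \<notin> {a, b} \<Longrightarrow> (G has_real_derivative indicator {a..b} x * u x) (at x)"
    and "\<And>x. x \<le> a \<Longrightarrow> G x = 0" and "\<And>x. b \<le> x \<Longrightarrow> G x = 1"
proof
  define U where "U x = integral {a..x} u" for x
  let ?G = "\<lambda>x. U (max a (min b x))"
  have U: "(U has_real_derivative u x) (at x within {a..b})" if "x \<in> {a..b}" for x
    unfolding U_def by (rule integral_has_real_derivative[OF u that])
  have "continuous_on {a..b} U"
    unfolding continuous_on_eq_continuous_within
  proof
    show "continuous (at x within {a..b}) U" if "x \<in> {a..b}" for x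
      using U[OF that] by (rule DERIV_continuous)
  qed
  moreover have "continuous_on UNIV (\<lambda>x. max a (min b x))"
    by (intro continuous_intros)
  moreover have "(\<lambda>x. max a (min b x)) ` UNIV \<subseteq> {a..b}"
    using assms(1) by auto
  ultimately show "continuous_on UNIV ?G"
    by (rule continuous_on_compose2)
  have Ua: "U a = 0"
    by (simp add: U_def)
  have "set_integrable lborel {a..b} u"
    unfolding set_integrable_def using u by (intro borel_integrable_compact) auto
  then have Ub: "U b = 1"
    using one set_borel_integral_eq_integral(2)[of "{a..b}" u]
    by (simp add: U_def set_lebesgue_integral_def)
  show "?G x = 0" if "x \<le> a" for x
    using that Ua assms(1) by (simp add: max_def min_def)
  show "?G x = 1" if "b \<le> x" for x
    using that Ub assms(1) by (simp add: max_def min_def)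
  fix x assume "x \<notin> {a, b}"
  then have "x \<noteq> a" "x \<noteq> b"
    by auto
  then consider "x < a" | "b < x" | "a < x" "x < b"
    by linarith
  then show "(?G has_real_derivative indicator {a..b} x * u x) (at x)"
  proof cases
    case 1
    have "(?G has_real_derivative 0) (at x)"
      by (rule has_field_derivative_transform_within_open[of "\<lambda>_. 0" 0 x "{..<a}"])
         (use 1 Ua assms(1) in \<open>auto simp: max_def min_def\<close>)
    with 1 show ?thesis by simp
  next
    case 2
    have "(?G has_real_derivative 0) (at x)"
      by (rule has_field_derivative_transform_within_open[of "\<lambda>_. 1" 0 x "{b<..}"])
         (use 2 Ub assms(1) in \<open>auto simp: max_def min_def\<close>)
    with 2 show ?thesis by simp
  next
    case 3
    then have "(U has_real_derivative u x) (at x)"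
      using U[of x] at_within_interior[of x "{a..b}"] by simp
    then have "(?G has_real_derivative u x) (at x)"
      by (rule has_field_derivative_transform_within_open[of _ _ _ "{a<..<b}"])
         (use 3 in \<open>auto simp: max_def min_def\<close>)
    with 3 show ?thesis by simp
  qed
qed

text \<open>Only the two plateaus are kept in the variance integral. Their contribution, minimised
  over the centre \<open>m\<close>, is the product of the masses divided by their sum, and that sum
  is at most one.\<close>

lemma Var_ge_mass_product:
  assumes "prob_space M" and [measurable]: "A \<in> sets M" "B \<in> sets M"
    and disj: "A \<inter> B = {}"
    and A: "\<And>z. z \<in> A \<Longrightarrow> f z = 1" and B: "\<And>z. z \<in> B \<Longrightarrow> f z = (0::real)"
  shows "ennreal (measure M A * measure M B) \<le> Var M f"
proof -
  interpret prob_space M by fact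
  define m where "m = (\<integral>w. f w \<partial>M)"
  let ?p = "measure M A" and ?q = "measure M B"
  have pq: "?p + ?q \<le> 1"
    using finite_measure_Union[OF assms(2,3) disj] prob_le_1[of "A \<union> B"] by simp
  \<comment> \<open>Only the value of the integrand on \<open>A \<union> B\<close> matters; \<open>m\<close> may be any real number, in particular
    the junk value \<open>0\<close> if \<open>f\<close> is not integrable.\<close>
  have "?p * ?q \<le> ?p * (1 - m)\<^sup>2 + ?q * m\<^sup>2"
  proof -
    \<comment> \<open>\<open>?r\<close> is the mass off \<open>A \<union> B\<close>. The identity
      holds because \<open>(?p + ?q) * (?p * (1 - m)\<^sup>2 + ?q * m\<^sup>2) - ?p * ?q\<close> is
      a perfect square.\<close>
    let ?r = "1 - (?p + ?q)"
    have "?p * (1 - m)\<^sup>2 + ?q * m\<^sup>2 - ?p * ?q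
        = (?p * (1 - m) - ?q * m)\<^sup>2 + ?r * (?p * (1 - m)\<^sup>2 + ?q * m\<^sup>2)"
      by (simp add: power2_eq_square algebra_simps)
    also have "\<dots> \<ge> 0"
      using pq by (intro add_nonneg_nonneg mult_nonneg_nonneg zero_le_power2 measure_nonneg) simp
    finally show ?thesis by simp
  qed
  then have "ennreal (?p * ?q) \<le> ennreal ((1 - m)\<^sup>2) * emeasure M A + ennreal (m\<^sup>2) * emeasure M B"
    by (simp add: emeasure_eq_measure ennreal_mult[symmetric] ennreal_plus[symmetric] mult.commute
        del: ennreal_plus)
  also have "\<dots> = (\<integral>\<^sup>+z. ennreal ((1 - m)\<^sup>2) * indicator A z + ennreal (m\<^sup>2) * indicator B z \<partial>M)"
    by (simp add: nn_integral_add nn_integral_cmult_indicator)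
  also have "\<dots> \<le> (\<integral>\<^sup>+z. ennreal ((f z - m)\<^sup>2) \<partial>M)"
  proof (rule nn_integral_mono)
    fix z
    consider "z \<in> A" "z \<notin> B" | "z \<in> B" "z \<notin> A" | "z \<notin> A" "z \<notin> B"
      using disj by blast
    then show "ennreal ((1 - m)\<^sup>2) * indicator A z + ennreal (m\<^sup>2) * indicator B z
        \<le> ennreal ((f z - m)\<^sup>2)"
      by cases (simp_all add: A B)
  qed
  finally show ?thesis
    by (simp add: Var_def m_def)
qed

section \<open>The two-temperature mixture\<close>

text \<open>Since \<open>exp y \<ge> y\<close>, an exponentially small factor can be traded for a
  power of \<open>\<tau>\<close>, which is all that the error terms need.\<close>

lemma exp_neg_inverse_le:
  fixes c \<tau> :: real
  assumes "0 < c" "0 < \<tau>"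
  shows "exp (- c / \<tau>) \<le> \<tau> / c"
proof -
  have "c / \<tau> \<le> exp (c / \<tau>)"
    using exp_ge_add_one_self[of "c / \<tau>"] by linarith
  then show ?thesis
    using assms by (simp add: exp_minus field_simps)
qed

text \<open>Integrating out the first coordinate uses up a unit mass and leaves the other factor, so
  \<open>\<alpha>\<close> ends up with \<open>q\<close> and \<open>\<beta>\<close> with
  \<open>p\<close>. Weights \<open>1\<close>, \<open>1\<close> yield the second marginal of
  \<open>mu\<close>; the two temperatures as weights yield the Dirichlet form.\<close>

lemma nn_integral_swap_mixture:
  fixes p q :: "real \<Rightarrow> real" and h :: "real \<Rightarrow> ennreal"
  assumes [measurable]: "p \<in> borel_measurable borel" "q \<in> borel_measurable borel"
      "h \<in> borel_measurable borel"
    and nonneg: "\<And>x. 0 \<le> p x" "\<And>x. 0 \<le> q x"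
    and one: "(\<integral>\<^sup>+x. ennreal (p x) \<partial>lborel) = 1" "(\<integral>\<^sup>+x. ennreal (q x) \<partial>lborel) = 1"
    and ab: "0 \<le> \<alpha>" "0 \<le> \<beta>"
  shows "(\<integral>\<^sup>+z. ennreal ((\<alpha> * (p (fst z) * q (snd z)) + \<beta> * (q (fst z) * p (snd z))) / 2) * h (snd z)
      \<partial>lborel) = (\<integral>\<^sup>+y. ennreal ((\<alpha> * q y + \<beta> * p y) / 2) * h y \<partial>lborel)"
proof -
  let ?F = "\<lambda>z. ennreal ((\<alpha> * (p (fst z) * q (snd z)) + \<beta> * (q (fst z) * p (snd z))) / 2) * h (snd z)"
  have "(\<integral>\<^sup>+z. ?F z \<partial>lborel) = (\<integral>\<^sup>+z. ?F z \<partial>(lborel \<Otimes>\<^sub>M lborel))"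
    by (simp add: lborel_prod)
  also have "\<dots> = (\<integral>\<^sup>+y. (\<integral>\<^sup>+x. ?F (x, y) \<partial>lborel) \<partial>lborel)"
    by (rule lborel_pair.nn_integral_snd[symmetric]) measurable
  also have "\<dots> = (\<integral>\<^sup>+y. ennreal ((\<alpha> * q y + \<beta> * p y) / 2) * h y \<partial>lborel)"
  proof (rule nn_integral_cong)
    fix y
    have "?F (x, y) = (ennreal (\<alpha> * q y / 2) * h y) * ennreal (p x)
        + (ennreal (\<beta> * p y / 2) * h y) * ennreal (q x)" for x
    proof -
      have "ennreal ((\<alpha> * (p x * q y) + \<beta> * (q x * p y)) / 2)
          = ennreal (\<alpha> * q y / 2) * ennreal (p x) + ennreal (\<beta> * p y / 2) * ennreal (q x)"
        using nonneg ab by (simp add: ennreal_mult[symmetric] ennreal_plus[symmetric] field_simps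
            del: ennreal_plus)
      then show ?thesis
        by (simp add: algebra_simps)
    qed
    then have "(\<integral>\<^sup>+x. ?F (x, y) \<partial>lborel)
        = ennreal (\<alpha> * q y / 2) * h y + ennreal (\<beta> * p y / 2) * h y"
      by (simp add: nn_integral_add nn_integral_cmult one)
    also have "\<dots> = ennreal ((\<alpha> * q y + \<beta> * p y) / 2) * h y"
      using nonneg ab by (simp add: distrib_right[symmetric] ennreal_plus[symmetric] add_divide_distrib
          del: ennreal_plus)
    finally show "(\<integral>\<^sup>+x. ?F (x, y) \<partial>lborel) = ennreal ((\<alpha> * q y + \<beta> * p y) / 2) * h y" .
  qed
  finally show ?thesis .
qed

lemma integral_pos_of_pos_on:
  fixes f :: "'a \<Rightarrow> real"
  assumes int: "integrable M f" and nonneg: "\<And>x. 0 \<le> f x"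
    and A: "A \<in> sets M" "emeasure M A \<noteq> 0" "\<And>x. x \<in> A \<Longrightarrow> 0 < f x"
  shows "0 < integral\<^sup>L M f"
proof -
  have "integral\<^sup>L M f \<noteq> 0"
  proof
    assume "integral\<^sup>L M f = 0"
    then have "AE x in M. f x = 0"
      using integral_nonneg_eq_0_iff_AE[OF int] nonneg by simp
    then have "AE x in M. x \<notin> A"
      by (rule AE_mp) (use A(3) in \<open>force intro!: AE_I2\<close>)
    then have "A \<in> null_sets M"
      using AE_iff_null_sets[OF A(1)] by simp
    then show False
      using A(2) by auto
  qed
  moreover have "0 \<le> integral\<^sup>L M f"
    using nonneg by (rule Bochner_Integration.integral_nonneg)
  ultimately show ?thesis by simp
qed

text \<open>What the measures need from the growth assumption: measurability of \<open>H\<close> and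
  a finite normalisation at every positive temperature.\<close>

locale confining_potential =
  fixes H :: "real \<Rightarrow> real"
  assumes cont: "continuous_on UNIV H"
    and integrable_exp: "0 < \<tau> \<Longrightarrow> integrable lborel (\<lambda>x. exp (- H x / \<tau>))"
begin

lemma measurable_potential [measurable]: "H \<in> borel_measurable borel"
  using cont by (rule borel_measurable_continuous_onI)

lemma partition_fn_pos: "0 < \<tau> \<Longrightarrow> 0 < partition_fn H \<tau>"
proof -
  assume "0 < \<tau>"
  then show ?thesis
    unfolding partition_fn_def
    by (intro integral_pos_of_pos_on[where A="{0..1}"] integrable_exp) auto
qed

lemma measurable_nu_density [measurable]: "nu_density H \<tau> \<in> borel_measurable borel"
  unfolding nu_density_def[abs_def] by measurable

lemma nu_density_pos: "0 < \<tau> \<Longrightarrow> 0 < nu_density H \<tau> x"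
  by (simp add: nu_density_def partition_fn_pos)

lemma integrable_nu_density: "0 < \<tau> \<Longrightarrow> integrable lborel (nu_density H \<tau>)"
  unfolding nu_density_def[abs_def] using integrable_exp by simp

lemma nn_integral_nu_density:
  assumes "0 < \<tau>"
  shows "(\<integral>\<^sup>+x. ennreal (nu_density H \<tau> x) \<partial>lborel) = 1"
proof -
  have "(\<integral>\<^sup>+x. ennreal (nu_density H \<tau> x) \<partial>lborel) = ennreal (\<integral>x. nu_density H \<tau> x \<partial>lborel)"
    using assms by (intro nn_integral_eq_integral integrable_nu_density)
      (auto intro!: less_imp_le nu_density_pos)
  also have "(\<integral>x. nu_density H \<tau> x \<partial>lborel) = 1"
    using partition_fn_pos[OF assms] by (simp add: nu_density_def partition_fn_def)
  finally show ?thesis by simp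
qed

lemma nn_integral_swapped_nu:
  assumes "0 < \<tau>\<^sub>1" "0 < \<tau>\<^sub>2" "0 \<le> \<alpha>" "0 \<le> \<beta>" and "h \<in> borel_measurable borel"
  shows "(\<integral>\<^sup>+z. ennreal ((\<alpha> * pi_plus H \<tau>\<^sub>1 \<tau>\<^sub>2 z + \<beta> * pi_minus H \<tau>\<^sub>1 \<tau>\<^sub>2 z) / 2) * h (snd z) \<partial>lborel)
    = (\<integral>\<^sup>+y. ennreal ((\<alpha> * nu_density H \<tau>\<^sub>2 y + \<beta> * nu_density H \<tau>\<^sub>1 y) / 2) * h y \<partial>lborel)"
  unfolding pi_plus_def pi_minus_def
  by (rule nn_integral_swap_mixture)
     (use assms in \<open>auto intro: nn_integral_nu_density less_imp_le nu_density_pos\<close>)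

lemma measurable_pi [measurable]:
  "pi_plus H \<tau>\<^sub>1 \<tau>\<^sub>2 \<in> borel_measurable borel" "pi_minus H \<tau>\<^sub>1 \<tau>\<^sub>2 \<in> borel_measurable borel"
  unfolding pi_plus_def[abs_def] pi_minus_def[abs_def] borel_prod[symmetric] by measurable

lemma measurable_a2 [measurable]: "a2 H \<tau>\<^sub>1 \<tau>\<^sub>2 \<in> borel_measurable borel"
  unfolding a2_def[abs_def] rho_plus_def rho_minus_def by measurable

lemma pi_pos:
  assumes "0 < \<tau>\<^sub>1" "0 < \<tau>\<^sub>2"
  shows "0 < pi_plus H \<tau>\<^sub>1 \<tau>\<^sub>2 z" "0 < pi_minus H \<tau>\<^sub>1 \<tau>\<^sub>2 z"
  using assms by (auto simp: pi_plus_def pi_minus_def intro!: mult_pos_pos nu_density_pos)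

lemma nn_integral_mu_snd:
  assumes "0 < \<tau>\<^sub>1" "0 < \<tau>\<^sub>2" and [measurable]: "h \<in> borel_measurable borel"
  shows "(\<integral>\<^sup>+z. h (snd z) \<partial>mu H \<tau>\<^sub>1 \<tau>\<^sub>2)
    = (\<integral>\<^sup>+y. ennreal ((nu_density H \<tau>\<^sub>2 y + nu_density H \<tau>\<^sub>1 y) / 2) * h y \<partial>lborel)"
proof -
  have [measurable]: "(\<lambda>z::real \<times> real. h (snd z)) \<in> borel_measurable borel"
    unfolding borel_prod[symmetric] by measurable
  show ?thesis
    using nn_integral_swapped_nu[of \<tau>\<^sub>1 \<tau>\<^sub>2 1 1 h] assms
    by (simp add: mu_def nn_integral_density)
qed

lemma prob_space_mu:
  assumes "0 < \<tau>\<^sub>1" "0 < \<tau>\<^sub>2"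
  shows "prob_space (mu H \<tau>\<^sub>1 \<tau>\<^sub>2)"
proof
  have "emeasure (mu H \<tau>\<^sub>1 \<tau>\<^sub>2) (space (mu H \<tau>\<^sub>1 \<tau>\<^sub>2)) = (\<integral>\<^sup>+z. 1 \<partial>mu H \<tau>\<^sub>1 \<tau>\<^sub>2)"
    by simp
  also have "\<dots> = (\<integral>\<^sup>+y. ennreal ((nu_density H \<tau>\<^sub>2 y + nu_density H \<tau>\<^sub>1 y) / 2) \<partial>lborel)"
    using nn_integral_mu_snd[OF assms, of "\<lambda>_. 1"] by simp
  also have "\<dots> = (\<integral>\<^sup>+y. (ennreal (nu_density H \<tau>\<^sub>2 y) + ennreal (nu_density H \<tau>\<^sub>1 y)) / 2 \<partial>lborel)"
    using assms by (intro nn_integral_cong)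
      (simp add: ennreal_plus[symmetric] divide_ennreal[symmetric] nu_density_pos less_imp_le
        del: ennreal_plus)
  also have "\<dots> = 1"
    using assms by (simp add: nn_integral_divide nn_integral_add nn_integral_nu_density)
  finally show "emeasure (mu H \<tau>\<^sub>1 \<tau>\<^sub>2) (space (mu H \<tau>\<^sub>1 \<tau>\<^sub>2)) = 1" .
qed

lemma measure_mu_snd:
  assumes "0 < \<tau>\<^sub>1" "0 < \<tau>\<^sub>2" and [measurable]: "A \<in> sets borel"
  shows "(\<lambda>z. snd z) -` A \<in> sets (mu H \<tau>\<^sub>1 \<tau>\<^sub>2)"
    and "measure (mu H \<tau>\<^sub>1 \<tau>\<^sub>2) (snd -` A)
      = (\<integral>y. indicator A y * ((nu_density H \<tau>\<^sub>2 y + nu_density H \<tau>\<^sub>1 y) / 2) \<partial>lborel)"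
proof -
  have "(snd :: real \<times> real \<Rightarrow> real) \<in> borel_measurable borel"
    unfolding borel_prod[symmetric] by measurable
  from measurable_sets[OF this assms(3)]
  show sets: "(\<lambda>z. snd z) -` A \<in> sets (mu H \<tau>\<^sub>1 \<tau>\<^sub>2)"
    by (simp add: mu_def)
  let ?d = "\<lambda>y. (nu_density H \<tau>\<^sub>2 y + nu_density H \<tau>\<^sub>1 y) / 2"
  have pos: "0 \<le> ?d y" for y
    using assms by (simp add: nu_density_pos less_imp_le)
  have "emeasure (mu H \<tau>\<^sub>1 \<tau>\<^sub>2) (snd -` A) = (\<integral>\<^sup>+z. indicator A (snd z) \<partial>mu H \<tau>\<^sub>1 \<tau>\<^sub>2)"
    using sets by (simp add: nn_integral_indicator[symmetric] indicator_def vimage_def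
        del: nn_integral_indicator)
  also have "\<dots> = (\<integral>\<^sup>+y. ennreal (?d y) * indicator A y \<partial>lborel)"
    using nn_integral_mu_snd[OF assms(1,2), of "indicator A"] by simp
  also have "\<dots> = (\<integral>\<^sup>+y. ennreal (indicator A y * ?d y) \<partial>lborel)"
    by (intro nn_integral_cong) (auto simp: indicator_def)
  also have "\<dots> = ennreal (\<integral>y. indicator A y * ?d y \<partial>lborel)"
  proof (rule nn_integral_eq_integral)
    have "integrable lborel ?d"
      using assms integrable_nu_density by simp
    then show "integrable lborel (\<lambda>y. indicator A y * ?d y)"
      using integrable_mult_indicator[of A lborel ?d] by simp
  qed (use pos in \<open>auto simp: indicator_def\<close>)
  finally show "measure (mu H \<tau>\<^sub>1 \<tau>\<^sub>2) (snd -` A) = (\<integral>y. indicator A y * ?d y \<partial>lborel)"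
    using pos by (simp add: measure_def integral_nonneg_AE)
qed

text \<open>The denominator of \<open>a2\<close> is twice the density of \<open>mu\<close> and
  cancels. What is left is the mixture with weight \<open>\<tau>\<^sub>2\<close> on
  \<open>pi_plus\<close> and \<open>\<tau>\<^sub>1\<close> on \<open>pi_minus\<close>, whose first
  coordinate integrates out.\<close>

lemma dirichlet_form_snd:
  assumes \<tau>: "0 < \<tau>\<^sub>1" "0 < \<tau>\<^sub>2" and [measurable]: "w \<in> borel_measurable borel"
  shows "dirichlet_form H \<tau>\<^sub>1 \<tau>\<^sub>2 (\<lambda>z. (0, w (snd z)))
    = (\<integral>\<^sup>+y. ennreal ((\<tau>\<^sub>2 * nu_density H \<tau>\<^sub>2 y + \<tau>\<^sub>1 * nu_density H \<tau>\<^sub>1 y) / 2) * ennreal ((w y)\<^sup>2) \<partial>lborel)"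
proof -
  let ?p = "pi_plus H \<tau>\<^sub>1 \<tau>\<^sub>2" and ?m = "pi_minus H \<tau>\<^sub>1 \<tau>\<^sub>2"
  note pos = pi_pos[OF \<tau>]
  have [measurable]: "(\<lambda>z::real \<times> real. w (snd z)) \<in> borel_measurable borel"
    unfolding borel_prod[symmetric] by measurable
  have "dirichlet_form H \<tau>\<^sub>1 \<tau>\<^sub>2 (\<lambda>z. (0, w (snd z)))
      = (\<integral>\<^sup>+z. ennreal ((?p z + ?m z) / 2) * ennreal (a2 H \<tau>\<^sub>1 \<tau>\<^sub>2 z * (w (snd z))\<^sup>2) \<partial>lborel)"
    unfolding dirichlet_form_def mu_def by (subst nn_integral_density) auto
  also have "\<dots> = (\<integral>\<^sup>+z. ennreal ((\<tau>\<^sub>2 * ?p z + \<tau>\<^sub>1 * ?m z) / 2) * ennreal ((w (snd z))\<^sup>2) \<partial>lborel)"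
  proof (rule nn_integral_cong)
    fix z :: "real \<times> real"
    have "?p z + ?m z > 0"
      using pos by (simp add: add_pos_pos)
    then have "a2 H \<tau>\<^sub>1 \<tau>\<^sub>2 z = (\<tau>\<^sub>2 * ?p z + \<tau>\<^sub>1 * ?m z) / (?p z + ?m z)"
      by (simp add: a2_def rho_plus_def rho_minus_def add_divide_distrib)
    then have eq: "(?p z + ?m z) / 2 * a2 H \<tau>\<^sub>1 \<tau>\<^sub>2 z = (\<tau>\<^sub>2 * ?p z + \<tau>\<^sub>1 * ?m z) / 2"
      using \<open>?p z + ?m z > 0\<close> by (simp add: field_simps)
    have "ennreal ((?p z + ?m z) / 2) * ennreal (a2 H \<tau>\<^sub>1 \<tau>\<^sub>2 z * (w (snd z))\<^sup>2)
        = ennreal ((?p z + ?m z) / 2 * a2 H \<tau>\<^sub>1 \<tau>\<^sub>2 z * (w (snd z))\<^sup>2)"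
      using pos[of z] by (subst ennreal_mult'[symmetric]) (simp_all add: mult.assoc)
    also have "\<dots> = ennreal ((\<tau>\<^sub>2 * ?p z + \<tau>\<^sub>1 * ?m z) / 2) * ennreal ((w (snd z))\<^sup>2)"
      unfolding eq using pos[of z] \<tau> by (intro ennreal_mult) (auto simp: less_imp_le)
    finally show "ennreal ((?p z + ?m z) / 2) * ennreal (a2 H \<tau>\<^sub>1 \<tau>\<^sub>2 z * (w (snd z))\<^sup>2)
        = ennreal ((\<tau>\<^sub>2 * ?p z + \<tau>\<^sub>1 * ?m z) / 2) * ennreal ((w (snd z))\<^sup>2)" .
  qed
  also have "\<dots> = (\<integral>\<^sup>+y. ennreal ((\<tau>\<^sub>2 * nu_density H \<tau>\<^sub>2 y + \<tau>\<^sub>1 * nu_density H \<tau>\<^sub>1 y) / 2)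
      * ennreal ((w y)\<^sup>2) \<partial>lborel)"
    using \<tau> by (intro nn_integral_swapped_nu) auto
  finally show ?thesis .
qed

section \<open>The quotient of variance and energy for the test function\<close>

text \<open>By Cauchy-Schwarz, among slopes \<open>w\<close> on \<open>{a..b}\<close> with unit
  integral the multiple of \<open>exp (H / \<tau>\<^sub>2)\<close> minimises the integral of
  \<open>w\<^sup>2 * exp (- H / \<tau>\<^sub>2)\<close>, with minimum \<open>1 / N\<close>. The
  number \<open>p\<close> bounds the mass to the right of \<open>a\<close>, and
  \<open>\<kappa>\<close> the energy of the cold component relative to the hot one.\<close>

lemma test_ratio_le_SUP:
  fixes \<tau>\<^sub>1 \<tau>\<^sub>2 a b I p \<kappa> :: real and S :: "real set"
  defines "N \<equiv> (\<integral>x. indicator {a..b} x * exp (H x / \<tau>\<^sub>2) \<partial>lborel)"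
  assumes \<tau>: "0 < \<tau>\<^sub>1" "0 < \<tau>\<^sub>2" and "a < b" and p: "p \<le> 1" and "0 \<le> \<kappa>"
    and S: "S \<in> sets borel" "S \<subseteq> {b..}"
    and I: "I = (\<integral>x. indicator S x * exp (- H x / \<tau>\<^sub>2) \<partial>lborel)"
    and tail: "\<And>\<tau>. \<tau> \<in> {\<tau>\<^sub>1, \<tau>\<^sub>2} \<Longrightarrow> (\<integral>x. indicator {a<..} x * nu_density H \<tau> x \<partial>lborel) \<le> p"
    and cold: "\<And>x. x \<in> {a..b} \<Longrightarrow> \<tau>\<^sub>1 * nu_density H \<tau>\<^sub>1 x \<le> \<kappa> * (\<tau>\<^sub>2 * nu_density H \<tau>\<^sub>2 x)"
  shows "ennreal (I * N / \<tau>\<^sub>2 * (1 - p) / (1 + \<kappa>)) \<le>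
    (SUP (f, g) \<in> {(f, g) \<in> H1 H \<tau>\<^sub>1 \<tau>\<^sub>2. dirichlet_form H \<tau>\<^sub>1 \<tau>\<^sub>2 g > 0}.
       Var (mu H \<tau>\<^sub>1 \<tau>\<^sub>2) f / dirichlet_form H \<tau>\<^sub>1 \<tau>\<^sub>2 g)"
proof -
  let ?\<mu> = "mu H \<tau>\<^sub>1 \<tau>\<^sub>2" and ?Z = "partition_fn H \<tau>\<^sub>2"
  let ?n1 = "nu_density H \<tau>\<^sub>1" and ?n2 = "nu_density H \<tau>\<^sub>2"
  interpret prob_space ?\<mu>
    using \<tau> by (rule prob_space_mu)
  have Z: "0 < ?Z"
    using \<tau> partition_fn_pos by simp
  have n: "0 < ?n1 x" "0 < ?n2 x" for x
    using \<tau> by (auto intro: nu_density_pos)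
  have ce: "continuous_on {a..b} (\<lambda>x. exp (H x / \<tau>\<^sub>2))"
    using cont \<tau> by (intro continuous_intros continuous_on_subset[OF cont]) auto
  have iN: "integrable lborel (\<lambda>x. indicator {a..b} x * exp (H x / \<tau>\<^sub>2))"
    using borel_integrable_compact[OF compact_Icc ce] by simp
  have N: "0 < N"
    unfolding N_def using \<open>a < b\<close>
    by (intro integral_pos_of_pos_on[where A="{a..b}", OF iN]) auto
  define u where "u x = exp (H x / \<tau>\<^sub>2) / N" for x
  define w where "w x = indicator {a..b} x * u x" for x
  have cu: "continuous_on {a..b} u"
    unfolding u_def using N by (intro continuous_on_divide ce continuous_on_const) auto
  have "(\<integral>x. indicator {a..b} x * u x \<partial>lborel) = 1"
    using N by (simp add: u_def N_def[symmetric])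
  from clamped_primitive[OF \<open>a < b\<close> cu this] obtain G where
    G: "continuous_on UNIV G" "\<And>x. x \<notin> {a, b} \<Longrightarrow> (G has_real_derivative w x) (at x)"
      "\<And>x. x \<le> a \<Longrightarrow> G x = 0" "\<And>x. b \<le> x \<Longrightarrow> G x = 1"
    unfolding w_def by metis
  have w_meas [measurable]: "w \<in> borel_measurable borel"
    unfolding w_def[abs_def] u_def by measurable
  obtain B where B: "\<And>x. \<bar>w x\<bar> \<le> B"
  proof -
    obtain B where B: "\<And>x. x \<in> {a..b} \<Longrightarrow> \<bar>u x\<bar> \<le> B"
      using compact_imp_bounded[OF compact_continuous_image[OF cu compact_Icc]]
      by (metis bounded_real imageI)
    have "0 \<le> B"
      using B[of a] \<open>a < b\<close> by auto
    then show thesis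
      using B by (intro that[of B]) (auto simp: w_def indicator_def)
  qed
  define f where "f z = G (snd z)" for z :: "real \<times> real"
  define g where "g z = (0::real, w (snd z))" for z :: "real \<times> real"
  have weak: "f has_weak_gradient g"
    unfolding f_def[abs_def] g_def[abs_def]
    by (rule has_weak_gradient_snd[where S="{a, b}", OF _ G(2,1) w_meas B]) simp_all
  have "(\<integral>\<^sup>+z. ennreal ((norm (g z))\<^sup>2) \<partial>?\<mu>) \<le> (\<integral>\<^sup>+z. ennreal (B\<^sup>2) \<partial>?\<mu>)"
    using B by (intro nn_integral_mono ennreal_leI) (simp add: g_def norm_Pair abs_le_square_iff[symmetric]
        order_trans[OF _ abs_ge_self])
  also have "\<dots> < \<infinity>"
    by (simp add: emeasure_space_1)
  finally have H1: "(f, g) \<in> H1 H \<tau>\<^sub>1 \<tau>\<^sub>2"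
    using weak by (simp add: H1_def)
  \<comment> \<open>\<open>(w y)\<^sup>2\<close> times the hot weight is again proportional to
    \<open>exp (H / \<tau>\<^sub>2)\<close>, so the energy is proportional to \<open>1 / N\<close>.
    The factor \<open>c\<close> lets one computation give both the lower bound
    (\<open>c = 1\<close>) and the upper bound (\<open>c = 1 + \<kappa>\<close>).\<close>
  have hot: "(\<integral>\<^sup>+y. ennreal (c * (\<tau>\<^sub>2 * ?n2 y) / 2) * ennreal ((w y)\<^sup>2) \<partial>lborel)
      = ennreal (c * \<tau>\<^sub>2 / (2 * ?Z * N))" if "0 \<le> c" for c
  proof -
    have "(\<integral>\<^sup>+y. ennreal (c * (\<tau>\<^sub>2 * ?n2 y) / 2) * ennreal ((w y)\<^sup>2) \<partial>lborel)
        = (\<integral>\<^sup>+y. ennreal (c * \<tau>\<^sub>2 / (2 * ?Z * N\<^sup>2) * (indicator {a..b} y * exp (H y / \<tau>\<^sub>2))) \<partial>lborel)"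
    proof (rule nn_integral_cong)
      fix y
      have "exp (- H y / \<tau>\<^sub>2) * (exp (H y / \<tau>\<^sub>2))\<^sup>2 = exp (H y / \<tau>\<^sub>2)"
        by (simp add: power2_eq_square exp_add[symmetric] mult.assoc[symmetric])
      then have "c * (\<tau>\<^sub>2 * ?n2 y) / 2 * (w y)\<^sup>2
          = c * \<tau>\<^sub>2 / (2 * ?Z * N\<^sup>2) * (indicator {a..b} y * exp (H y / \<tau>\<^sub>2))"
        using N Z by (auto simp: w_def u_def nu_density_def indicator_def power_divide field_simps)
      then show "ennreal (c * (\<tau>\<^sub>2 * ?n2 y) / 2) * ennreal ((w y)\<^sup>2)
          = ennreal (c * \<tau>\<^sub>2 / (2 * ?Z * N\<^sup>2) * (indicator {a..b} y * exp (H y / \<tau>\<^sub>2)))"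
        by (simp only: ennreal_mult''[OF zero_le_power2, symmetric])
    qed
    also have "\<dots> = ennreal (c * \<tau>\<^sub>2 / (2 * ?Z * N\<^sup>2) * N)"
      unfolding N_def using that \<tau> Z N iN
      by (subst nn_integral_eq_integral) (auto simp: indicator_def)
    finally show ?thesis
      using N by (simp add: power2_eq_square mult.assoc)
  qed
  have E: "dirichlet_form H \<tau>\<^sub>1 \<tau>\<^sub>2 g
      = (\<integral>\<^sup>+y. ennreal ((\<tau>\<^sub>2 * ?n2 y + \<tau>\<^sub>1 * ?n1 y) / 2) * ennreal ((w y)\<^sup>2) \<partial>lborel)"
    unfolding g_def[abs_def] using \<tau> by (intro dirichlet_form_snd) auto
  define e where "e = (1 + \<kappa>) * \<tau>\<^sub>2 / (2 * ?Z * N)"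
  have e: "0 < e"
    using \<tau> Z N \<open>0 \<le> \<kappa>\<close> by (simp add: e_def)
  \<comment> \<open>Dropping the cold part shows that the energy is positive, so the pair is
    admissible in the supremum.\<close>
  have "ennreal (\<tau>\<^sub>2 / (2 * ?Z * N)) = (\<integral>\<^sup>+y. ennreal (1 * (\<tau>\<^sub>2 * ?n2 y) / 2) * ennreal ((w y)\<^sup>2) \<partial>lborel)"
    using hot[of 1] by simp
  also have "\<dots> \<le> dirichlet_form H \<tau>\<^sub>1 \<tau>\<^sub>2 g"
    unfolding E using \<tau> n
    by (intro nn_integral_mono mult_right_mono ennreal_leI) (auto simp: less_imp_le)
  finally have E_ge: "ennreal (\<tau>\<^sub>2 / (2 * ?Z * N)) \<le> dirichlet_form H \<tau>\<^sub>1 \<tau>\<^sub>2 g" .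
  have "0 < ennreal (\<tau>\<^sub>2 / (2 * ?Z * N))"
    using \<tau> Z N by simp
  from less_le_trans[OF this E_ge] have E_pos: "0 < dirichlet_form H \<tau>\<^sub>1 \<tau>\<^sub>2 g" .
  have "dirichlet_form H \<tau>\<^sub>1 \<tau>\<^sub>2 g
      \<le> (\<integral>\<^sup>+y. ennreal ((1 + \<kappa>) * (\<tau>\<^sub>2 * ?n2 y) / 2) * ennreal ((w y)\<^sup>2) \<partial>lborel)"
    unfolding E
  proof (rule nn_integral_mono)
    fix y
    show "ennreal ((\<tau>\<^sub>2 * ?n2 y + \<tau>\<^sub>1 * ?n1 y) / 2) * ennreal ((w y)\<^sup>2)
        \<le> ennreal ((1 + \<kappa>) * (\<tau>\<^sub>2 * ?n2 y) / 2) * ennreal ((w y)\<^sup>2)"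
    proof (cases "y \<in> {a..b}")
      case True
      then show ?thesis
        using cold[OF True] by (intro mult_right_mono ennreal_leI) (auto simp: algebra_simps)
    qed (simp add: w_def)
  qed
  also have "\<dots> = ennreal e"
    using hot[of "1 + \<kappa>"] \<open>0 \<le> \<kappa>\<close> by (simp add: e_def)
  finally have E_le: "dirichlet_form H \<tau>\<^sub>1 \<tau>\<^sub>2 g \<le> ennreal e" .

  let ?d = "\<lambda>y. (?n2 y + ?n1 y) / 2"
  have ind: "integrable lborel (\<lambda>y. indicator T y * ?n2 y)" "integrable lborel (\<lambda>y. indicator T y * ?n1 y)"
    if "T \<in> sets borel" for T
    using that \<tau> integrable_mult_indicator[OF _ integrable_nu_density, of T] by simp_all
  \<comment> \<open>Only the hot half of the marginal density is kept, whence the factor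
    \<open>1 / 2\<close>.\<close>
  have mS: "I / (2 * ?Z) \<le> measure ?\<mu> (snd -` {b..})"
  proof -
    have "I / (2 * ?Z) = (\<integral>y. indicator S y * ?n2 y \<partial>lborel) / 2"
      by (simp add: I nu_density_def)
    also have "\<dots> = (\<integral>y. indicator S y * ?n2 y / 2 \<partial>lborel)"
      by simp
    also have "\<dots> \<le> (\<integral>y. indicator {b..} y * ?d y \<partial>lborel)"
    proof (rule integral_mono)
      show "integrable lborel (\<lambda>y. indicator {b..} y * ?d y)"
        using integrable_mult_indicator[of "{b..}" lborel ?d] integrable_nu_density \<tau> by simp
      show "indicator S y * ?n2 y / 2 \<le> indicator {b..} y * ?d y" for y
        using S(2) n[of y] by (auto simp: indicator_def less_imp_le)
    qed (use ind S in simp)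
    also have "\<dots> = measure ?\<mu> (snd -` {b..})"
      using measure_mu_snd(2)[OF \<tau>, of "{b..}"] by simp
    finally show ?thesis .
  qed
  have m0: "1 - p \<le> measure ?\<mu> (snd -` {..a})"
  proof -
    have "measure ?\<mu> (snd -` {a<..}) = (\<integral>y. indicator {a<..} y * ?d y \<partial>lborel)"
      using measure_mu_snd(2)[OF \<tau>, of "{a<..}"] by simp
    also have "\<dots> = ((\<integral>y. indicator {a<..} y * ?n2 y \<partial>lborel) + (\<integral>y. indicator {a<..} y * ?n1 y \<partial>lborel)) / 2"
    proof -
      have "indicator {a<..} y * ?d y = (indicator {a<..} y * ?n2 y + indicator {a<..} y * ?n1 y) / 2"
        for y
        by (simp add: distrib_left)
      then show ?thesis
        using ind[of "{a<..}"] by simp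
    qed
    also have "\<dots> \<le> p"
      using tail[of \<tau>\<^sub>1] tail[of \<tau>\<^sub>2] by simp
    finally have "measure ?\<mu> (snd -` {a<..}) \<le> p" .
    moreover have "snd -` {..a} = space ?\<mu> - snd -` {a<..}"
      by (auto simp: mu_def)
    ultimately show ?thesis
      using prob_compl[OF measure_mu_snd(1)[OF \<tau>, of "{a<..}"]] by simp
  qed
  have "ennreal (I / (2 * ?Z) * (1 - p)) \<le> ennreal (measure ?\<mu> (snd -` {b..}) * measure ?\<mu> (snd -` {..a}))"
    using mS m0 p by (intro ennreal_leI mult_mono) auto
  also have "\<dots> \<le> Var ?\<mu> f"
    using \<open>a < b\<close> G(3,4) measure_mu_snd(1)[OF \<tau>]
    by (intro Var_ge_mass_product prob_space_axioms) (auto simp: f_def)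
  finally have V: "ennreal (I / (2 * ?Z) * (1 - p)) \<le> Var ?\<mu> f" .
  have "0 \<le> I"
    unfolding I by (intro integral_nonneg_AE) auto
  \<comment> \<open>The factor \<open>2 * ?Z\<close> sits in the denominators of both the variance
    bound and \<open>e\<close>, and cancels.\<close>
  have "I * N / \<tau>\<^sub>2 * (1 - p) / (1 + \<kappa>) = (I / (2 * ?Z) * (1 - p)) / e"
  proof -
    have "I * N / t * q / k = (I / (2 * ?Z) * q) / (k * t / (2 * ?Z * N))" for q k t
      using Z by (simp add: mult_ac)
    then show ?thesis
      unfolding e_def .
  qed
  then have "ennreal (I * N / \<tau>\<^sub>2 * (1 - p) / (1 + \<kappa>)) = ennreal (I / (2 * ?Z) * (1 - p)) / ennreal e"
    using e \<open>0 \<le> I\<close> p Z by (simp add: divide_ennreal)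
  also have "\<dots> \<le> Var ?\<mu> f / dirichlet_form H \<tau>\<^sub>1 \<tau>\<^sub>2 g"
  proof -
    \<comment> \<open>The energy is positive and at most \<open>e\<close>, hence a positive real,
      and the quotients can be compared in the reals.\<close>
    obtain e' where e': "dirichlet_form H \<tau>\<^sub>1 \<tau>\<^sub>2 g = ennreal e'" "0 < e'" "e' \<le> e"
      using E_le E_pos e
      by (cases "dirichlet_form H \<tau>\<^sub>1 \<tau>\<^sub>2 g") (auto simp: ennreal_le_iff top_unique)
    have "ennreal (I / (2 * ?Z) * (1 - p)) / ennreal e \<le> ennreal (I / (2 * ?Z) * (1 - p)) / ennreal e'"
      using e e' \<open>0 \<le> I\<close> p Z by (simp add: divide_ennreal divide_left_mono)
    also have "\<dots> \<le> Var ?\<mu> f / ennreal e'"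
      using V by (rule divide_right_mono_ennreal)
    finally show ?thesis
      by (simp add: e')
  qed
  also have "\<dots> \<le> (SUP (f, g) \<in> {(f, g) \<in> H1 H \<tau>\<^sub>1 \<tau>\<^sub>2. dirichlet_form H \<tau>\<^sub>1 \<tau>\<^sub>2 g > 0}.
       Var ?\<mu> f / dirichlet_form H \<tau>\<^sub>1 \<tau>\<^sub>2 g)"
    by (rule SUP_upper2[of "(f, g)"]) (use H1 E_pos in auto)
  finally show ?thesis .
qed

section \<open>Smallness of the tail mass and of the cold component\<close>

lemma partition_fn_mono:
  assumes "\<And>x. 0 \<le> H x" "0 < \<sigma>" "\<sigma> \<le> \<tau>"
  shows "partition_fn H \<sigma> \<le> partition_fn H \<tau>"
  unfolding partition_fn_def
proof (rule integral_mono)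
  show "exp (- H x / \<sigma>) \<le> exp (- H x / \<tau>)" for x
    using divide_left_mono[of \<sigma> \<tau> "H x"] assms by simp
  show "integrable lborel (\<lambda>x. exp (- H x / \<sigma>))" "integrable lborel (\<lambda>x. exp (- H x / \<tau>))"
    using assms(2,3) by (intro integrable_exp; linarith)+
qed

text \<open>For \<open>\<tau> \<le> 1\<close> and \<open>\<delta> \<le> H x\<close> one has
  \<open>H x / \<tau> \<ge> H x + \<delta> / \<tau> - \<delta>\<close>: a factor
  \<open>exp (- \<delta> / \<tau>)\<close> splits off and the rest integrates to at most
  \<open>partition_fn H 1\<close>. This factor is at most of order \<open>\<tau>\<close> and the
  normalisation at least of order \<open>sqrt \<tau>\<close>.\<close>

lemma tail_mass_le:
  assumes \<tau>: "0 < \<tau>" "\<tau> \<le> 1" and c: "0 < c" "c * sqrt \<tau> \<le> partition_fn H \<tau>"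
    and \<delta>: "0 < \<delta>" "\<And>x. a < x \<Longrightarrow> \<delta> \<le> H x"
  shows "(\<integral>x. indicator {a<..} x * nu_density H \<tau> x \<partial>lborel)
    \<le> partition_fn H 1 * exp \<delta> / (c * \<delta>) * sqrt \<tau>"
proof -
  let ?Z = "partition_fn H \<tau>"
  have Z: "0 < ?Z" "0 < partition_fn H 1"
    using \<tau> partition_fn_pos by auto
  have "(\<integral>x. indicator {a<..} x * nu_density H \<tau> x \<partial>lborel)
      \<le> (\<integral>x. exp (\<delta> - \<delta> / \<tau>) / ?Z * exp (- H x / 1) \<partial>lborel)"
  proof (rule integral_mono)
    show "integrable lborel (\<lambda>x. indicator {a<..} x * nu_density H \<tau> x)"
      using integrable_mult_indicator[OF _ integrable_nu_density[OF \<tau>(1)], of "{a<..}"] by simp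
    show "integrable lborel (\<lambda>x. exp (\<delta> - \<delta> / \<tau>) / ?Z * exp (- H x / 1))"
      by (intro integrable_mult_right integrable_exp) simp
    fix x
    show "indicator {a<..} x * nu_density H \<tau> x \<le> exp (\<delta> - \<delta> / \<tau>) / ?Z * exp (- H x / 1)"
    proof (cases "a < x")
      case True
      have "0 \<le> (H x - \<delta>) * (1 / \<tau> - 1)"
        using \<delta>(2)[OF True] \<tau> by (intro mult_nonneg_nonneg) (auto simp: field_simps)
      then have "- H x / \<tau> \<le> (\<delta> - \<delta> / \<tau>) + - H x / 1"
        by (simp add: algebra_simps)
      then have "exp (- H x / \<tau>) \<le> exp (\<delta> - \<delta> / \<tau>) * exp (- H x / 1)"
        unfolding exp_add[symmetric] exp_le_cancel_iff .
      then show ?thesis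
        using True Z by (simp add: nu_density_def divide_right_mono)
    qed (use Z in simp)
  qed
  also have "\<dots> = exp (\<delta> - \<delta> / \<tau>) / ?Z * partition_fn H 1"
    unfolding partition_fn_def by simp
  also have "\<dots> = partition_fn H 1 * exp \<delta> * (exp (- \<delta> / \<tau>) / ?Z)"
    by (simp add: exp_diff exp_minus field_simps)
  also have "\<dots> \<le> partition_fn H 1 * exp \<delta> * ((\<tau> / \<delta>) / (c * sqrt \<tau>))"
    using exp_neg_inverse_le[OF \<delta>(1) \<tau>(1)] c \<tau> \<delta>(1) Z by (intro mult_left_mono frac_le) auto
  also have "\<dots> = partition_fn H 1 * exp \<delta> / (c * \<delta>) * (\<tau> / sqrt \<tau>)"
    by simp
  finally show ?thesis
    using \<tau> by (simp add: real_div_sqrt)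
qed

text \<open>The temperature ratio gives \<open>H x / \<tau>\<^sub>1 \<ge> H x / \<tau>\<^sub>2 + (K
  - 1) * H x / \<tau>\<^sub>2\<close>, so the cold weight carries an extra factor
  \<open>exp (- \<delta> * (K - 1) / \<tau>\<^sub>2)\<close>, which is traded for a multiple of
  \<open>\<tau>\<^sub>2\<close>.\<close>

lemma cold_density_le:
  assumes nonneg: "\<And>x. 0 \<le> H x" and \<tau>: "0 < \<tau>\<^sub>1" "\<tau>\<^sub>2 \<le> 1" "K * \<tau>\<^sub>1 \<le> \<tau>\<^sub>2" and "1 < K"
    and c: "0 < c" "c * sqrt \<tau>\<^sub>1 \<le> partition_fn H \<tau>\<^sub>1" and \<delta>: "0 < \<delta>" "\<delta> \<le> H x"
  shows "\<tau>\<^sub>1 * nu_density H \<tau>\<^sub>1 x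
    \<le> partition_fn H 1 / (c * (\<delta> * (K - 1))) * sqrt \<tau>\<^sub>2 * (\<tau>\<^sub>2 * nu_density H \<tau>\<^sub>2 x)"
proof -
  let ?Z1 = "partition_fn H \<tau>\<^sub>1" and ?Z2 = "partition_fn H \<tau>\<^sub>2" and ?E = "exp (- H x / \<tau>\<^sub>2)"
  have "\<tau>\<^sub>1 \<le> K * \<tau>\<^sub>1"
    using \<tau>(1) \<open>1 < K\<close> by simp
  then have t2: "\<tau>\<^sub>1 \<le> \<tau>\<^sub>2" "0 < \<tau>\<^sub>2"
    using \<tau> by linarith+
  have Z: "0 < ?Z1" "0 < ?Z2" "?Z2 \<le> partition_fn H 1"
    using \<tau> t2 partition_fn_pos partition_fn_mono[OF nonneg] by auto
  have "\<tau>\<^sub>1 / ?Z1 \<le> \<tau>\<^sub>1 / (c * sqrt \<tau>\<^sub>1)"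
    using \<tau> c Z by (intro divide_left_mono) auto
  also have "\<dots> = \<tau>\<^sub>1 / sqrt \<tau>\<^sub>1 / c"
    by simp
  also have "\<dots> = sqrt \<tau>\<^sub>1 / c"
    using \<tau>(1) by (simp only: real_div_sqrt less_imp_le)
  also have "\<dots> \<le> sqrt \<tau>\<^sub>2 / c"
    using t2 c by (simp add: divide_right_mono)
  finally have pre: "\<tau>\<^sub>1 / ?Z1 \<le> sqrt \<tau>\<^sub>2 / c" .
  have "exp (- H x / \<tau>\<^sub>1) \<le> ?E * exp (- (\<delta> * (K - 1)) / \<tau>\<^sub>2)"
  proof -
    have "K / \<tau>\<^sub>2 \<le> 1 / \<tau>\<^sub>1"
      using \<tau> t2 by (simp add: field_simps)
    then have "H x * (K / \<tau>\<^sub>2) \<le> H x * (1 / \<tau>\<^sub>1)"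
      using nonneg by (intro mult_left_mono) auto
    moreover have "\<delta> * ((K - 1) / \<tau>\<^sub>2) \<le> H x * ((K - 1) / \<tau>\<^sub>2)"
      using \<delta> \<open>1 < K\<close> t2 by (intro mult_right_mono) auto
    ultimately have "- H x / \<tau>\<^sub>1 \<le> - H x / \<tau>\<^sub>2 + - (\<delta> * (K - 1)) / \<tau>\<^sub>2"
      by (simp add: algebra_simps diff_divide_distrib)
    then show ?thesis
      unfolding exp_add[symmetric] exp_le_cancel_iff .
  qed
  also have "\<dots> \<le> ?E * (\<tau>\<^sub>2 / (\<delta> * (K - 1)))"
    using \<delta> \<open>1 < K\<close> t2 by (intro mult_left_mono exp_neg_inverse_le) auto
  finally have "\<tau>\<^sub>1 / ?Z1 * exp (- H x / \<tau>\<^sub>1) \<le> sqrt \<tau>\<^sub>2 / c * (?E * (\<tau>\<^sub>2 / (\<delta> * (K - 1))))"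
    using pre c t2 by (intro mult_mono) auto
  \<comment> \<open>\<open>?Z2\<close> rebuilds the density at \<open>\<tau>\<^sub>2\<close> and is
    then bounded by the normalisation at temperature \<open>1\<close>, which makes the constant
    independent of the temperatures.\<close>
  also have "\<dots> = ?Z2 * (1 / (c * (\<delta> * (K - 1))) * sqrt \<tau>\<^sub>2 * (\<tau>\<^sub>2 * nu_density H \<tau>\<^sub>2 x))"
    using Z by (simp add: nu_density_def)
  also have "\<dots> \<le> partition_fn H 1 * (1 / (c * (\<delta> * (K - 1))) * sqrt \<tau>\<^sub>2 * (\<tau>\<^sub>2 * nu_density H \<tau>\<^sub>2 x))"
    using Z(3) c \<delta> \<open>1 < K\<close> t2 nu_density_pos[OF t2(2), of x]
    by (intro mult_right_mono) (auto simp: less_imp_le)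
  finally show ?thesis
    by (simp add: nu_density_def)
qed

end

section \<open>Asymptotics\<close>

text \<open>The last hypothesis turns the additive \<open>A\<close> into a relative error
  \<open>B * \<epsilon>\<close>. As \<open>4 * D * \<epsilon> \<le> 1 / 2\<close>, at least half of
  \<open>?C * \<epsilon>\<close> survives multiplication by \<open>1 - 4 * (D * \<epsilon>)\<close>;
  the \<open>2\<close> in \<open>?C\<close> makes up for the other half.\<close>

lemma relative_error_absorbed:
  fixes A D \<epsilon> M :: real
  assumes "0 \<le> A" "0 \<le> D" "0 \<le> B" "0 \<le> \<epsilon>" "8 * D * \<epsilon> \<le> 1" "0 \<le> M" and A: "A \<le> B * \<epsilon> * M"
  shows "M * (1 + A * \<epsilon>) + A \<le> (1 + 2 * (A + B + 4 * D) * \<epsilon>) * (M * (1 - 4 * (D * \<epsilon>)))"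
proof -
  let ?C = "2 * (A + B + 4 * D)"
  have "?C * \<epsilon> * (4 * (D * \<epsilon>)) \<le> ?C * \<epsilon> * (1 / 2)"
    using assms by (intro mult_left_mono) auto
  then have "1 + (A + B) * \<epsilon> \<le> (1 + ?C * \<epsilon>) * (1 - 4 * (D * \<epsilon>))"
    by (simp add: algebra_simps)
  from mult_left_mono[OF this, of M] assms
  have "M * (1 + (A + B) * \<epsilon>) \<le> (1 + ?C * \<epsilon>) * (M * (1 - 4 * (D * \<epsilon>)))"
    by (simp add: mult_ac)
  moreover have "M * (1 + A * \<epsilon>) + A \<le> M * (1 + (A + B) * \<epsilon>)"
    using A by (simp add: algebra_simps)
  ultimately show ?thesis by linarith
qed

text \<open>This bundles four losses: the two Laplace bounds give \<open>(1 - x) ^ 2\<close>, the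
  mass on the zero plateau gives \<open>1 - x\<close>, and the cold energy gives
  \<open>1 + x\<close> in the denominator.\<close>

lemma one_minus_cube_over_ge:
  fixes x :: real
  assumes "0 \<le> x" "x \<le> 1"
  shows "1 - 4 * x \<le> (1 - x) ^ 2 * (1 - x) / (1 + x)"
proof -
  have "(1 - 4 * x) * (1 + x) \<le> (1 - x) ^ 2 * (1 - x)"
  proof -
    have "(1 - x) ^ 2 * (1 - x) - (1 - 4 * x) * (1 + x) = x\<^sup>2 * (7 - x)"
      by (simp add: power2_eq_square algebra_simps)
    also have "\<dots> \<ge> 0"
      using assms by simp
    finally show ?thesis by simp
  qed
  then show ?thesis
    using assms by (simp add: pos_le_divide_eq)
qed

lemma sqrt_ln_error_small:
  fixes D :: real
  obtains \<tau>\<^sub>0 where "0 < \<tau>\<^sub>0" "\<tau>\<^sub>0 < 1"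
    and "\<And>\<tau>. 0 < \<tau> \<Longrightarrow> \<tau> \<le> \<tau>\<^sub>0 \<Longrightarrow> sqrt \<tau> \<le> sqrt \<tau> * \<bar>ln \<tau>\<bar> powr (3/2)"
    and "\<And>\<tau>. 0 < \<tau> \<Longrightarrow> \<tau> \<le> \<tau>\<^sub>0 \<Longrightarrow> D * (sqrt \<tau> * \<bar>ln \<tau>\<bar> powr (3/2)) \<le> 1"
proof -
  have "((\<lambda>\<tau>::real. sqrt \<tau> * \<bar>ln \<tau>\<bar> powr (3/2)) \<longlongrightarrow> 0) (at_right 0)"
    by real_asymp
  from tendsto_mult_left[OF this, of D]
  have "((\<lambda>\<tau>::real. D * (sqrt \<tau> * \<bar>ln \<tau>\<bar> powr (3/2))) \<longlongrightarrow> 0) (at_right 0)"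
    by simp
  then have "\<forall>\<^sub>F \<tau> in at_right 0. D * (sqrt \<tau> * \<bar>ln \<tau>\<bar> powr (3/2)) < 1"
    by (rule order_tendstoD) simp
  then obtain b :: real where b: "b > 0" "\<And>\<tau>. 0 < \<tau> \<Longrightarrow> \<tau> < b \<Longrightarrow> D * (sqrt \<tau> * \<bar>ln \<tau>\<bar> powr (3/2)) < 1"
    unfolding eventually_at_right_field by auto
  show ?thesis
  \<comment> \<open>\<open>\<tau> \<le> exp (- 1)\<close> forces
    \<open>\<bar>ln \<tau>\<bar> \<ge> 1\<close>, so the logarithmic factor only enlarges
    \<open>sqrt \<tau>\<close>; \<open>b / 2\<close> stays strictly inside the range given by the
    limit.\<close>
  proof (rule that[of "min (b / 2) (exp (- 1))"])
    fix \<tau> :: real assume \<tau>: "0 < \<tau>" "\<tau> \<le> min (b / 2) (exp (- 1))"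
    then have "ln \<tau> \<le> - 1"
      using ln_le_cancel_iff[of \<tau> "exp (- 1)"] by simp
    then have "1 \<le> \<bar>ln \<tau>\<bar> powr (3/2)"
      by (intro ge_one_powr_ge_zero) auto
    then show "sqrt \<tau> \<le> sqrt \<tau> * \<bar>ln \<tau>\<bar> powr (3/2)"
      using \<tau> by simp
    show "D * (sqrt \<tau> * \<bar>ln \<tau>\<bar> powr (3/2)) \<le> 1"
      using b \<tau> by (intro less_imp_le b(2)) auto
  qed (use b in \<open>auto simp: min_less_iff_disj\<close>)
qed

section \<open>Choice of the constants and combination of the estimates\<close>

theorem proposition2p13:
  fixes H :: "real \<Rightarrow> real" and m\<^sub>1 m\<^sub>2 s \<delta> K :: real
  assumes "growth_PI H"
    and "{x. deriv H x = 0} = {m\<^sub>1, s, m\<^sub>2}" and "m\<^sub>1 < s" and "s < m\<^sub>2"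
    and "local_min H m\<^sub>1" and "local_min H m\<^sub>2" and "local_max H s"
    and "H m\<^sub>1 = 0" and "0 < \<delta>" and "\<delta> \<le> H m\<^sub>2"
    and "K > 1"
  shows "\<forall>A\<ge>0. \<exists>C::real. \<exists>\<tau>\<^sub>0. 0 < \<tau>\<^sub>0 \<and> \<tau>\<^sub>0 < 1 \<and>
    (\<forall>\<tau>\<^sub>1 \<tau>\<^sub>2. 0 < \<tau>\<^sub>1 \<and> \<tau>\<^sub>1 < \<tau>\<^sub>2 \<and> \<tau>\<^sub>2 \<le> \<tau>\<^sub>0 \<and> \<tau>\<^sub>2 \<ge> K * \<tau>\<^sub>1 \<longrightarrow>
      ennreal (inv_rho_PI H m\<^sub>2 s \<tau>\<^sub>2 A) \<le>
        ennreal (1 + C * sqrt \<tau>\<^sub>2 * \<bar>ln \<tau>\<^sub>2\<bar> powr (3/2)) *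
        (SUP (f, g) \<in> {(f, g) \<in> H1 H \<tau>\<^sub>1 \<tau>\<^sub>2. dirichlet_form H \<tau>\<^sub>1 \<tau>\<^sub>2 g > 0}.
           Var (mu H \<tau>\<^sub>1 \<tau>\<^sub>2) f / dirichlet_form H \<tau>\<^sub>1 \<tau>\<^sub>2 g))"
proof (intro allI impI)
  fix A :: real assume A: "0 \<le> A"
  have C3: "C_k 3 H" and nonneg: "\<And>x. 0 \<le> H x"
    and morse: "\<And>x. deriv H x = 0 \<Longrightarrow> deriv (deriv H) x \<noteq> 0"
    using assms(1) by (auto simp: growth_PI_def)
  have crit: "deriv H x = 0 \<longleftrightarrow> x \<in> {m\<^sub>1, s, m\<^sub>2}" for x
    using assms(2) by blast
  note geo = double_well_geometry[OF C3 morse crit assms(3-7)]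
  obtain r where r: "0 < r" "s + r < m\<^sub>2" "\<And>x. s - r \<le> x \<Longrightarrow> H m\<^sub>2 \<le> H x"
    using geo(5) by blast
  then have high: "\<delta> \<le> H x" if "s - r \<le> x" for x
    using that assms(10) order_trans by blast
  interpret confining_potential H
  proof
    show "continuous_on UNIV H"
      by (meson C_3_real(1)[OF C3] DERIV_continuous continuous_at_imp_continuous_on)
  qed (rule growth_PI_integrable[OF assms(1)])

  define k where "k = deriv (deriv H) m\<^sub>2"
  define l where "l = - deriv (deriv H) s"
  define \<Delta> where "\<Delta> = H s - H m\<^sub>2"
  have pos: "0 < k" "0 < l" "0 < \<Delta>"
    using geo(2-4) by (auto simp: k_def l_def \<Delta>_def)
  \<comment> \<open>The largest radius about \<open>m\<^sub>2\<close> whose interval stays in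
    \<open>{s + r..}\<close>, where the test function equals \<open>1\<close>.\<close>
  define R where "R = m\<^sub>2 - (s + r)"
  \<comment> \<open>Because \<open>H m\<^sub>1 = 0\<close>, this bound has no exponential factor and
    makes the normalisation at least of order \<open>sqrt \<tau>\<close>.\<close>
  obtain C1 where C1: "C1 \<ge> 0" "\<And>\<tau>. 0 < \<tau> \<Longrightarrow> \<tau> \<le> 1 \<Longrightarrow>
    sqrt (2 * pi * \<tau> / deriv (deriv H) m\<^sub>1) * (1 - C1 * sqrt \<tau>)
      \<le> (\<integral>x. indicator {m\<^sub>1 - 1..m\<^sub>1 + 1} x * exp (- H x / \<tau>) \<partial>lborel)"
    using laplace_lower_bound_critical[OF C3, of m\<^sub>1 1 1] crit[of m\<^sub>1] geo(1) assms(8) by auto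
  obtain C2 where C2: "C2 \<ge> 0" "\<And>\<tau>. 0 < \<tau> \<Longrightarrow> \<tau> \<le> 1 \<Longrightarrow>
    exp (- H m\<^sub>2 / \<tau>) * (sqrt (2 * pi * \<tau> / k) * (1 - C2 * sqrt \<tau>))
      \<le> (\<integral>x. indicator {m\<^sub>2 - R..m\<^sub>2 + R} x * exp (- H x / \<tau>) \<partial>lborel)"
    using laplace_lower_bound_critical[OF C3, of m\<^sub>2 1 R] crit[of m\<^sub>2] geo(2) r
    by (auto simp: k_def R_def)
  obtain C3' where C3': "C3' \<ge> 0" "\<And>\<tau>. 0 < \<tau> \<Longrightarrow> \<tau> \<le> 1 \<Longrightarrow>
    exp (H s / \<tau>) * (sqrt (2 * pi * \<tau> / l) * (1 - C3' * sqrt \<tau>))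
      \<le> (\<integral>x. indicator {s - r..s + r} x * exp (H x / \<tau>) \<partial>lborel)"
    using laplace_lower_bound_critical[OF C3, of s "-1" r] crit[of s] geo(3) r
    by (auto simp: l_def)

  \<comment> \<open>Half of the Laplace constant at \<open>m\<^sub>1\<close>: for small temperatures
    \<open>1 - C1 * sqrt \<tau>\<close> is at least \<open>1 / 2\<close>.\<close>
  define c where "c = sqrt (2 * pi / deriv (deriv H) m\<^sub>1) / 2"
  have c: "0 < c"
    using geo(1) by (simp add: c_def)
  define P where "P = partition_fn H 1 * exp \<delta> / (c * \<delta>)"
  define Q where "Q = partition_fn H 1 / (c * (\<delta> * (K - 1)))"
  have PQ: "0 \<le> P" "0 \<le> Q"
    using c assms(9,11) partition_fn_pos[of 1] by (auto simp: P_def Q_def)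
  \<comment> \<open>The sum dominates each of the five error constants, so that a single
    \<open>x = D * sqrt \<tau>\<^sub>2\<close> bounds all the errors.\<close>
  define D where "D = C1 + C2 + C3' + P + Q"
  have D: "C1 \<le> D" "C2 \<le> D" "C3' \<le> D" "P \<le> D" "Q \<le> D" "0 \<le> D"
    using C1(1) C2(1) C3'(1) PQ by (auto simp: D_def)
  define m where "m = 2 * pi / sqrt (k * l)"
  have m: "0 < m"
    using pos by (simp add: m_def)
  \<comment> \<open>Chosen so that \<open>exp (\<Delta> / \<tau>\<^sub>2) \<ge> \<Delta> /
    \<tau>\<^sub>2\<close> and \<open>\<tau>\<^sub>2 \<le> \<epsilon>\<close> yield
    \<open>A \<le> B * \<epsilon> * M\<close>.\<close>
  define B where "B = A / (m * \<Delta>)"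
  have B: "0 \<le> B"
    using A m pos by (simp add: B_def)
  obtain \<tau>\<^sub>0 where \<tau>\<^sub>0: "0 < \<tau>\<^sub>0" "\<tau>\<^sub>0 < 1"
    "\<And>\<tau>. 0 < \<tau> \<Longrightarrow> \<tau> \<le> \<tau>\<^sub>0 \<Longrightarrow> sqrt \<tau> \<le> sqrt \<tau> * \<bar>ln \<tau>\<bar> powr (3/2)"
    "\<And>\<tau>. 0 < \<tau> \<Longrightarrow> \<tau> \<le> \<tau>\<^sub>0 \<Longrightarrow> 8 * D * (sqrt \<tau> * \<bar>ln \<tau>\<bar> powr (3/2)) \<le> 1"
    using sqrt_ln_error_small[of "8 * D"] by blast
  let ?C = "2 * (A + B + 4 * D)"

  show "\<exists>C::real. \<exists>\<tau>\<^sub>0. 0 < \<tau>\<^sub>0 \<and> \<tau>\<^sub>0 < 1 \<and>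
    (\<forall>\<tau>\<^sub>1 \<tau>\<^sub>2. 0 < \<tau>\<^sub>1 \<and> \<tau>\<^sub>1 < \<tau>\<^sub>2 \<and> \<tau>\<^sub>2 \<le> \<tau>\<^sub>0 \<and> \<tau>\<^sub>2 \<ge> K * \<tau>\<^sub>1 \<longrightarrow>
      ennreal (inv_rho_PI H m\<^sub>2 s \<tau>\<^sub>2 A) \<le>
        ennreal (1 + C * sqrt \<tau>\<^sub>2 * \<bar>ln \<tau>\<^sub>2\<bar> powr (3/2)) *
        (SUP (f, g) \<in> {(f, g) \<in> H1 H \<tau>\<^sub>1 \<tau>\<^sub>2. dirichlet_form H \<tau>\<^sub>1 \<tau>\<^sub>2 g > 0}.
           Var (mu H \<tau>\<^sub>1 \<tau>\<^sub>2) f / dirichlet_form H \<tau>\<^sub>1 \<tau>\<^sub>2 g))"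
  proof (rule exI[of _ ?C], rule exI[of _ \<tau>\<^sub>0], intro conjI allI impI \<tau>\<^sub>0(1,2))
    fix \<tau>\<^sub>1 \<tau>\<^sub>2 :: real
    assume "0 < \<tau>\<^sub>1 \<and> \<tau>\<^sub>1 < \<tau>\<^sub>2 \<and> \<tau>\<^sub>2 \<le> \<tau>\<^sub>0 \<and> K * \<tau>\<^sub>1 \<le> \<tau>\<^sub>2"
    then have \<tau>: "0 < \<tau>\<^sub>1" "\<tau>\<^sub>1 < \<tau>\<^sub>2" "\<tau>\<^sub>2 \<le> \<tau>\<^sub>0" "K * \<tau>\<^sub>1 \<le> \<tau>\<^sub>2" "0 < \<tau>\<^sub>2" "\<tau>\<^sub>2 \<le> 1"
      using \<tau>\<^sub>0(2) by auto
    define \<epsilon> where "\<epsilon> = sqrt \<tau>\<^sub>2 * \<bar>ln \<tau>\<^sub>2\<bar> powr (3/2)"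
    have \<epsilon>: "0 \<le> \<epsilon>" "sqrt \<tau>\<^sub>2 \<le> \<epsilon>" "8 * D * \<epsilon> \<le> 1"
      using \<tau>\<^sub>0(3,4)[OF \<tau>(5,3)] \<tau> by (auto simp: \<epsilon>_def)
    define x where "x = D * sqrt \<tau>\<^sub>2"
    have x: "0 \<le> x" "x \<le> D * \<epsilon>" "8 * x \<le> 1"
    proof -
      show "0 \<le> x" "x \<le> D * \<epsilon>"
        using D(6) \<epsilon>(2) \<tau> by (auto simp: x_def mult_left_mono)
      then show "8 * x \<le> 1"
        using \<epsilon>(3) by simp
    qed
    have le_x: "u * sqrt \<tau> \<le> x" if "0 \<le> u" "u \<le> D" "0 \<le> \<tau>" "\<tau> \<le> \<tau>\<^sub>2" for u \<tau>
      unfolding x_def using that D(6) by (intro mult_mono) auto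
    \<comment> \<open>Stated for all temperatures up to \<open>\<tau>\<^sub>2\<close>, since the
      normalisations at both \<open>\<tau>\<^sub>1\<close> and \<open>\<tau>\<^sub>2\<close> must be
      bounded below.\<close>
    have Z_ge: "c * sqrt \<tau> \<le> partition_fn H \<tau>" if "0 < \<tau>" "\<tau> \<le> \<tau>\<^sub>2" for \<tau>
    proof -
      have "c * sqrt \<tau> = sqrt (2 * pi * \<tau> / deriv (deriv H) m\<^sub>1) * (1 / 2)"
        by (simp add: c_def real_sqrt_mult real_sqrt_divide)
      also have "\<dots> \<le> sqrt (2 * pi * \<tau> / deriv (deriv H) m\<^sub>1) * (1 - C1 * sqrt \<tau>)"
        using le_x[OF C1(1) D(1), of \<tau>] x(3) that geo(1) by (intro mult_left_mono) auto
      also have "\<dots> \<le> (\<integral>x. indicator {m\<^sub>1 - 1..m\<^sub>1 + 1} x * exp (- H x / \<tau>) \<partial>lborel)"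
        using that \<tau> by (intro C1(2)) auto
      also have "\<dots> \<le> partition_fn H \<tau>"
        unfolding partition_fn_def
        using integrable_mult_indicator[OF _ integrable_exp[OF that(1)], of "{m\<^sub>1 - 1..m\<^sub>1 + 1}"]
          integrable_exp[OF that(1)]
        by (intro integral_mono) (auto simp: indicator_def)
      finally show ?thesis .
    qed
    define N where "N = (\<integral>x. indicator {s - r..s + r} x * exp (H x / \<tau>\<^sub>2) \<partial>lborel)"
    define I where "I = (\<integral>x. indicator {m\<^sub>2 - R..m\<^sub>2 + R} x * exp (- H x / \<tau>\<^sub>2) \<partial>lborel)"
    have "ennreal (I * N / \<tau>\<^sub>2 * (1 - x) / (1 + x)) \<le>
      (SUP (f, g) \<in> {(f, g) \<in> H1 H \<tau>\<^sub>1 \<tau>\<^sub>2. dirichlet_form H \<tau>\<^sub>1 \<tau>\<^sub>2 g > 0}.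
         Var (mu H \<tau>\<^sub>1 \<tau>\<^sub>2) f / dirichlet_form H \<tau>\<^sub>1 \<tau>\<^sub>2 g)" (is "_ \<le> ?SUP")
      unfolding N_def
    \<comment> \<open>The test function climbs on \<open>{s - r..s + r}\<close>, the hot mass is
      collected around \<open>m\<^sub>2\<close>, and \<open>x\<close> plays the role of both
      \<open>p\<close> and \<open>\<kappa>\<close>.\<close>
    proof (rule test_ratio_le_SUP[OF \<tau>(1,5) _ _ x(1) _ _ I_def])
      show "{m\<^sub>2 - R..m\<^sub>2 + R} \<subseteq> {s + r..}"
        by (auto simp: R_def)
      show "(\<integral>x. indicator {s - r<..} x * nu_density H \<tau> x \<partial>lborel) \<le> x"
        if "\<tau> \<in> {\<tau>\<^sub>1, \<tau>\<^sub>2}" for \<tau>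
      proof -
        have t: "0 < \<tau>" "\<tau> \<le> 1" "\<tau> \<le> \<tau>\<^sub>2"
          using that \<tau> by auto
        have "(\<integral>x. indicator {s - r<..} x * nu_density H \<tau> x \<partial>lborel) \<le> P * sqrt \<tau>"
          unfolding P_def by (rule tail_mass_le[OF t(1,2) c Z_ge assms(9)]) (use t high in auto)
        also have "\<dots> \<le> x"
          using t PQ D by (intro le_x) auto
        finally show ?thesis .
      qed
      show "\<tau>\<^sub>1 * nu_density H \<tau>\<^sub>1 y \<le> x * (\<tau>\<^sub>2 * nu_density H \<tau>\<^sub>2 y)" if "y \<in> {s - r..s + r}" for y
      proof -
        have "\<tau>\<^sub>1 * nu_density H \<tau>\<^sub>1 y \<le> Q * sqrt \<tau>\<^sub>2 * (\<tau>\<^sub>2 * nu_density H \<tau>\<^sub>2 y)"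
          unfolding Q_def
          by (rule cold_density_le[OF nonneg \<tau>(1,6,4) assms(11) c Z_ge assms(9)])
             (use \<tau> that high in auto)
        also have "\<dots> \<le> x * (\<tau>\<^sub>2 * nu_density H \<tau>\<^sub>2 y)"
          using PQ D \<tau> nu_density_pos[OF \<tau>(5), of y] by (intro mult_right_mono le_x) (auto simp: less_imp_le)
        finally show ?thesis .
      qed
    qed (use r x in auto)
    moreover define M where "M = m * exp (\<Delta> / \<tau>\<^sub>2)"
    have "M * (1 - 4 * (D * \<epsilon>)) \<le> I * N / \<tau>\<^sub>2 * (1 - x) / (1 + x)"
    proof -
      let ?i = "exp (- H m\<^sub>2 / \<tau>\<^sub>2) * sqrt (2 * pi * \<tau>\<^sub>2 / k)"
      let ?n = "exp (H s / \<tau>\<^sub>2) * sqrt (2 * pi * \<tau>\<^sub>2 / l)"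
      have "?i * (1 - x) \<le> ?i * (1 - C2 * sqrt \<tau>\<^sub>2)"
        using le_x[OF C2(1) D(2), of \<tau>\<^sub>2] \<tau> pos by (intro mult_left_mono) auto
      also have "\<dots> \<le> I"
        using C2(2)[OF \<tau>(5,6)] by (simp add: I_def mult.assoc)
      finally have I: "?i * (1 - x) \<le> I" .
      have "?n * (1 - x) \<le> ?n * (1 - C3' * sqrt \<tau>\<^sub>2)"
        using le_x[OF C3'(1) D(3), of \<tau>\<^sub>2] \<tau> pos by (intro mult_left_mono) auto
      also have "\<dots> \<le> N"
        using C3'(2)[OF \<tau>(5,6)] by (simp add: N_def mult.assoc)
      finally have N: "?n * (1 - x) \<le> N" .
      have "exp (- H m\<^sub>2 / \<tau>\<^sub>2) * exp (H s / \<tau>\<^sub>2) = exp (\<Delta> / \<tau>\<^sub>2)"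
        by (simp add: \<Delta>_def exp_add[symmetric] diff_divide_distrib)
      \<comment> \<open>The product of the two Gaussian widths supplies the prefactor
        \<open>m\<close> and a factor \<open>\<tau>\<^sub>2\<close> that cancels the division by
        \<open>\<tau>\<^sub>2\<close> in the quotient.\<close>
      moreover have "sqrt (2 * pi * \<tau>\<^sub>2 / k) * sqrt (2 * pi * \<tau>\<^sub>2 / l) = m * \<tau>\<^sub>2"
      proof -
        have "sqrt (2 * pi * \<tau>\<^sub>2 / k) * sqrt (2 * pi * \<tau>\<^sub>2 / l) = sqrt ((2 * pi * \<tau>\<^sub>2)\<^sup>2 / (k * l))"
          by (simp add: real_sqrt_mult[symmetric] power2_eq_square)
        also have "\<dots> = m * \<tau>\<^sub>2"
          using \<tau> by (simp only: real_sqrt_divide real_sqrt_abs m_def) simp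
        finally show ?thesis .
      qed
      ultimately have "?i * ?n = M * \<tau>\<^sub>2"
        unfolding M_def by (metis mult.assoc mult.commute)
      then have "M * (1 - x)\<^sup>2 = (?i * (1 - x)) * (?n * (1 - x)) / \<tau>\<^sub>2"
        using \<tau>(5) by (simp add: power2_eq_square field_simps)
      also have "\<dots> \<le> I * N / \<tau>\<^sub>2"
        using I N x \<tau> pos
        by (intro divide_right_mono mult_mono) (auto intro: order_trans[rotated])
      finally have IN: "M * (1 - x)\<^sup>2 \<le> I * N / \<tau>\<^sub>2" .
      \<comment> \<open>Here \<open>x\<close> is weakened to \<open>D * \<epsilon>\<close>, the
        logarithmic error scale of the claim.\<close>
      have "M * (1 - 4 * (D * \<epsilon>)) \<le> M * (1 - 4 * x)"
        using x m by (intro mult_left_mono) (auto simp: M_def)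
      also have "\<dots> \<le> M * ((1 - x)\<^sup>2 * (1 - x) / (1 + x))"
        using x m by (intro mult_left_mono one_minus_cube_over_ge) (auto simp: M_def)
      also have "\<dots> = M * (1 - x)\<^sup>2 * ((1 - x) / (1 + x))"
        by simp
      also have "\<dots> \<le> I * N / \<tau>\<^sub>2 * ((1 - x) / (1 + x))"
        using IN x by (intro mult_right_mono) auto
      finally show ?thesis by simp
    qed
    ultimately have lower: "ennreal (M * (1 - 4 * (D * \<epsilon>))) \<le> ?SUP"
      by (meson ennreal_leI order_trans)
    have "A \<le> B * \<epsilon> * M"
    proof -
      have "\<tau>\<^sub>2 \<le> sqrt \<tau>\<^sub>2"
        using \<tau> by (simp add: real_le_rsqrt power2_eq_square mult_left_le_one_le)
      then have "\<Delta> \<le> \<epsilon> * (\<Delta> / \<tau>\<^sub>2)"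
        using \<epsilon>(2) \<tau>(5) pos(3) by (simp add: field_simps)
      also have "\<dots> \<le> \<epsilon> * exp (\<Delta> / \<tau>\<^sub>2)"
        using \<epsilon>(1) exp_ge_add_one_self[of "\<Delta> / \<tau>\<^sub>2"] by (intro mult_left_mono) linarith+
      finally have "B * m * \<Delta> \<le> B * m * (\<epsilon> * exp (\<Delta> / \<tau>\<^sub>2))"
        using B m by (intro mult_left_mono) auto
      then show ?thesis
        using m pos by (simp add: B_def M_def mult_ac)
    qed
    from relative_error_absorbed[OF A D(6) B \<epsilon>(1,3) _ this]
    have "M * (1 + A * \<epsilon>) + A \<le> (1 + ?C * \<epsilon>) * (M * (1 - 4 * (D * \<epsilon>)))"
      using m by (simp add: M_def)
    moreover have "inv_rho_PI H m\<^sub>2 s \<tau>\<^sub>2 A = M * (1 + A * \<epsilon>) + A"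
      using geo(3) by (simp add: inv_rho_PI_def M_def m_def k_def l_def \<Delta>_def \<epsilon>_def mult.assoc)
    ultimately have "ennreal (inv_rho_PI H m\<^sub>2 s \<tau>\<^sub>2 A) \<le> ennreal ((1 + ?C * \<epsilon>) * (M * (1 - 4 * (D * \<epsilon>))))"
      by (simp add: ennreal_leI)
    also have "\<dots> = ennreal (1 + ?C * \<epsilon>) * ennreal (M * (1 - 4 * (D * \<epsilon>)))"
      using A B D(6) \<epsilon>(1) by (intro ennreal_mult') simp
    also have "\<dots> \<le> ennreal (1 + ?C * \<epsilon>) * ?SUP"
      using lower by (rule mult_left_mono) simp
    finally show "ennreal (inv_rho_PI H m\<^sub>2 s \<tau>\<^sub>2 A) \<le>
        ennreal (1 + ?C * sqrt \<tau>\<^sub>2 * \<bar>ln \<tau>\<^sub>2\<bar> powr (3/2)) * ?SUP"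
      by (simp only: \<epsilon>_def mult.assoc)
  qed
qed

end
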